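(* Let $m\ge3$, $n\ge1$, and let $P_m,P_{m-1},P_{m-2}$ be homogeneous operators of order $m,m-1,m-2$ on $\mathbb{R}_t\times\mathbb{R}^n_x$, with $c_{m,0}=1$, $c_{m-1,0}>0$, $c_{m-2,0}>0$. Let $P_{m-2}(\partial_t,\partial_x)$ and $P_m(\partial_t,\partial_x)$ be (possibly weakly) hyperbolic and $P_{m-1}(\partial_t,\partial_x)$ be strictly hyperbolic. Assume that $P_{m-2}(\lambda,\xi')$ and $P_{m-1}(\lambda,\xi')$ interlace and that $P_{m-1}(\lambda,\xi')$ and $P_m(\lambda,\xi')$ interlace, for any $\xi'\in S^{n-1}$, and that there is no $(\lambda,\xi')\in\mathbb{R}\times S^{n-1}$ such that $P_{m-2}(\lambda,\xi')=P_{m-1}(\lambda,\xi')=P_m(\lambda,\xi')=0$. Let $d_j(\xi')$ be the roots of $P_{m-2}(\lambda,\xi')$, $\xi'\in S^{n-1}$, and let $Q_2=P_m+P_{m-1}+P_{m-2}$. Then we may label the $m$ roots $\lambda_j(\xi)$, $\xi\in\mathbb{R}^n$, of $Q_2(\lambda,i\xi)$ in such a way that $\lambda_{m-1}(0)$, $\lambda_m(0)$ are $$\lambda_{m-1,m}(0)=\begin{cases}\dfrac{-c_{m-1,0}\pm\sqrt{c_{m-1,0}^2-4c_{m-2,0}}}2&\text{if }c_{m-1,0}^2\ge4c_{m-2,0},\\[2mm]\dfrac{-c_{m-1,0}\pm i\sqrt{4c_{m-2,0}-c_{m-1,0}^2}}2&\text{if }c_{m-1,0}^2<4c_{m-2,0},\end{cases}$$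 and $\lambda_j(\xi)$, $j=1,\ldots,m-2$, are described as follows, where $\xi'=\xi/|\xi|$. (i) If $P_{m-1}(d_j(\xi'),\xi')\ne0$ and $\check P_{m-2,j}(d_j(\xi'),\xi')\ne0$, that is, $d_j(\xi')$ is a simple root of $P_{m-2}(\lambda,\xi')$ and it is not a root of $P_{m-1}(\lambda,\xi')$, then, as $\xi\to0$, $$\lambda_j(\xi)=i|\xi|d_j(\xi')+|\xi|^2\frac{P_{m-1}(d_j(\xi'),\xi')}{\check P_{m-2,j}(d_j(\xi'),\xi')}+o(|\xi|^2).$$ (ii) If $P_{m-1}(d_j(\xi'),\xi')=0$ and $\check P_{m-2,j}(d_j(\xi'),\xi')\ne0$, that is, $d_j(\xi')$ is a simple root of both $P_{m-1}(\lambda,\xi')$ and $P_{m-2}(\lambda,\xi')$, then, as $\xi\to0$, $$\lambda_j(\xi)=i|\xi|d_j(\xi')+i|\xi|^3\frac{P_m(d_j(\xi'),\xi')}{\check P_{m-2,j}(d_j(\xi'),\xi')}+|\xi|^4\frac{P_m(d_j(\xi'),\xi')\,\tilde P_{m-1}(d_j(\xi'),\xi')}{\big(\check P_{m-2,j}(d_j(\xi'),\xi')\big)^2}+o(|\xi|^4),$$ where $\tilde P_{m-1}(\lambda,\xi')=\check P_{m-1,j}(\lambda,\xi')$ if $d_j(\xi')=b_j(\xi')$, and $\tilde P_{m-1}(\lambda,\xi')=\check P_{m-1,j+1}(\lambda,\xi')$ if $d_j(\xi')=b_{j+1}(\xi')$. (iii) If $d_j(\xi')=b_{j+1}(\xi')=d_{j+1}(\xi')$,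 that is, $d_j(\xi')$ is a simple root of $P_{m-1}(\lambda,\xi')$ and a double root of $P_{m-2}(\lambda,\xi')$, then, as $\xi\to0$, $$\lambda_{j,j+1}(\xi)=i|\xi|d_j(\xi')+|\xi|^2\kappa_\pm(\xi')+o(|\xi|^2),$$ where $\kappa_\pm(\xi')$ are the two solutions to $$\kappa^2\check P_{m-2,j,j+1}(d_j(\xi'),\xi')-\kappa\,\check P_{m-1,j+1}(d_j(\xi'),\xi')+P_m(d_j(\xi'),\xi')=0 .$$
   Context: A homogeneous operator of order $r$ is $P_r(\partial_t,\partial_x)=\sum_{k+|\alpha|=r}c_{k,\alpha}\partial_t^k\partial_x^\alpha$ with constant coefficients and $c_{r,0}>0$; its symbol is $P_r(\lambda,\xi)=\sum_{k+|\alpha|=r}c_{k,\alpha}\lambda^k\xi^\alpha$, and $P_r(\lambda,i\xi)$ denotes the symbol with $\xi$ replaced by $i\xi$. It is hyperbolic if, for every $\xi'\in S^{n-1}=\{\xi\in\mathbb{R}^n:|\xi|=1\}$, the polynomial $\lambda\mapsto P_r(\lambda,\xi')$ has only real roots, and strictly hyperbolic if in addition these roots are distinct for every $\xi'$. If $p_{r-1}$, $p_r$ are polynomials of degree $r-1$, $r$ with real roots $\tilde\lambda_1\le\dots\le\tilde\lambda_{r-1}$ and $\lambda_1\le\dots\le\lambda_r$ (with multiplicity), they interlace if $\lambda_1\le\tilde\lambda_1\le\lambda_2\le\dots\le\tilde\lambda_{r-1}\le\lambda_r$. For $\xi'\in S^{n-1}$, $b_1(\xi')\le\dots\le b_{m-1}(\xi')$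 and $d_1(\xi')\le\dots\le d_{m-2}(\xi')$ are the roots of $P_{m-1}(\lambda,\xi')$ and $P_{m-2}(\lambda,\xi')$. As polynomials in $\lambda$: $\check P_{m-1,j}(\lambda,\xi')=P_{m-1}(\lambda,\xi')/(\lambda-b_j(\xi'))$, $\check P_{m-2,j}(\lambda,\xi')=P_{m-2}(\lambda,\xi')/(\lambda-d_j(\xi'))$, $\check P_{m-2,j,j+1}(\lambda,\xi')=P_{m-2}(\lambda,\xi')/\big((\lambda-d_j(\xi'))(\lambda-d_{j+1}(\xi'))\big)$. The case distinction and the expansions are for given $\xi'\in S^{n-1}$, with $\xi=|\xi|\xi'$ and $|\xi|\to0$. *)

theory Defs
  imports
    "HOL-Analysis.Analysis"
    "HOL-Computational_Algebra.Computational_Algebra"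
    "HOL-Library.Landau_Symbols"
begin

text \<open>
  An operator of order \<open>r\<close> is given by its coefficients: \<open>P k \<alpha>\<close> is the coefficient of
  \<open>\<partial>\<^sub>t\<^sup>k \<partial>\<^sub>x\<^sup>\<alpha>\<close>, for a multi-index \<open>\<alpha>\<close>. Only the entries with \<open>k + |\<alpha>| = r\<close> matter.
  The coefficients are taken real: hyperbolicity and a positive coefficient of \<open>\<partial>\<^sub>t\<^sup>r\<close> force this.
\<close>

type_synonym 'n coeffs = "nat \<Rightarrow> ('n \<Rightarrow> nat) \<Rightarrow> real"

definition indices :: "nat \<Rightarrow> (nat \<times> ('n::finite \<Rightarrow> nat)) set"
  where "indices r = {(k, \<alpha>). k + (\<Sum>i\<in>UNIV. \<alpha> i) = r}"

lemma finite_indices: "finite (indices r :: (nat \<times> ('n::finite \<Rightarrow> nat)) set)"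
proof (rule finite_subset)
  show "indices r \<subseteq> {..r} \<times> (PiE UNIV (\<lambda>_. {..r}) :: ('n \<Rightarrow> nat) set)"
  proof
    fix x :: "nat \<times> ('n \<Rightarrow> nat)" assume x: "x \<in> indices r"
    have "snd x i \<le> (\<Sum>i\<in>UNIV. snd x i)" for i by (rule member_le_sum) auto
    then have "snd x i \<le> r" for i
      using x by (fastforce simp: indices_def intro: order_trans)
    with x show "x \<in> {..r} \<times> PiE UNIV (\<lambda>_. {..r})" by (cases x) (auto simp: indices_def)
  qed
  show "finite ({..r} \<times> (PiE UNIV (\<lambda>_. {..r}) :: ('n \<Rightarrow> nat) set))"
    by (intro finite_cartesian_product finite_PiE) auto
qed

text \<open>The symbol as a polynomial in \<open>\<lambda>\<close>, for a real or complex vector \<open>\<xi>\<close>.\<close>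

definition symbol :: "nat \<Rightarrow> 'n::finite coeffs \<Rightarrow> 'a::real_normed_field ^ 'n \<Rightarrow> 'a poly"
  where "symbol r P \<xi> = (\<Sum>(k, \<alpha>)\<in>indices r. monom (of_real (P k \<alpha>) * (\<Prod>i\<in>UNIV. \<xi> $ i ^ \<alpha> i)) k)"

definition times_ii :: "real ^ 'n \<Rightarrow> complex ^ 'n"
  where "times_ii \<xi> = (\<chi> i. \<i> * complex_of_real (\<xi> $ i))"

definition real_rooted :: "real poly \<Rightarrow> bool"
  where "real_rooted p \<longleftrightarrow> (\<forall>z. poly (map_poly complex_of_real p) z = 0 \<longrightarrow> z \<in> \<real>)"

text \<open>Roots in increasing order, repeated according to multiplicity; \<open>nth_root p j\<close> counts from 1.\<close>

definition real_roots :: "real poly \<Rightarrow> real list"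
  where "real_roots p = sorted_list_of_multiset (proots p)"

definition nth_root :: "real poly \<Rightarrow> nat \<Rightarrow> real"
  where "nth_root p j = real_roots p ! (j - 1)"

definition hyperbolic :: "nat \<Rightarrow> 'n::finite coeffs \<Rightarrow> bool"
  where "hyperbolic r P \<longleftrightarrow> (\<forall>\<xi>' :: real ^ 'n. norm \<xi>' = 1 \<longrightarrow> real_rooted (symbol r P \<xi>'))"

definition strictly_hyperbolic :: "nat \<Rightarrow> 'n::finite coeffs \<Rightarrow> bool"
  where "strictly_hyperbolic r P \<longleftrightarrow> hyperbolic r P \<and>
    (\<forall>\<xi>' :: real ^ 'n. norm \<xi>' = 1 \<longrightarrow> distinct (real_roots (symbol r P \<xi>')))"

definition interlace :: "real poly \<Rightarrow> real poly \<Rightarrow> bool"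
  where "interlace p q \<longleftrightarrow> real_rooted p \<and> real_rooted q \<and> degree q = degree p + 1 \<and>
    (\<forall>j\<in>{1..degree p}. nth_root q j \<le> nth_root p j \<and> nth_root p j \<le> nth_root q (j + 1))"

text \<open>The quotients \<open>p / (\<lambda> - r\<^sub>j)\<close> and \<open>p / ((\<lambda> - r\<^sub>j) (\<lambda> - r\<^sub>j\<^sub>+\<^sub>1))\<close>, where \<open>r\<^sub>j\<close> is the \<open>j\<close>-th root of \<open>p\<close>.\<close>

definition omit_root :: "real poly \<Rightarrow> nat \<Rightarrow> real poly"
  where "omit_root p j = p div [:- nth_root p j, 1:]"

definition omit_root2 :: "real poly \<Rightarrow> nat \<Rightarrow> real poly"
  where "omit_root2 p j = p div ([:- nth_root p j, 1:] * [:- nth_root p (j + 1), 1:])"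

end

theory Submission
  imports Defs
begin

text \<open>
  On the ray through a unit vector \<open>\<xi>'\<close> homogeneity gives
  \<open>Q\<^sub>2(\<i> r \<mu>, \<i> r \<xi>') = (\<i> r)\<^sup>m\<^sup>-\<^sup>2 (p\<^sub>2(\<mu>) + \<i> r p\<^sub>1(\<mu>) - r\<^sup>2 p\<^sub>0(\<mu>))\<close>,
  where \<open>p\<^sub>0\<close>, \<open>p\<^sub>1\<close>, \<open>p\<^sub>2\<close> are the symbols of \<open>P\<^sub>m\<close>, \<open>P\<^sub>m\<^sub>-\<^sub>1\<close>, \<open>P\<^sub>m\<^sub>-\<^sub>2\<close> at \<open>\<xi>'\<close>. So the small roots of \<open>Q\<^sub>2\<close> are
  \<open>\<lambda> = \<i> r \<mu>\<close> with \<open>\<mu>\<close> near a root of \<open>p\<^sub>2\<close>; two further roots \<open>\<mu>\<close> escape to infinity and belong to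
  \<open>\<lambda>\<^sub>m\<^sub>-\<^sub>1\<close> and \<open>\<lambda>\<^sub>m\<close>.

  The tool is a persistence theorem for roots that tolerates a loss of degree in the limit
  (\<open>split_off_roots\<close>): if polynomials of bounded degree converge coefficientwise to a nonzero limit,
  then linear factors converging to those of the limit can be split off, with a converging cofactor.
  Applied to the bracket above, it gives roots \<open>\<mu>\<^sub>j \<longlongrightarrow> d\<^sub>j\<close>, counted with multiplicity.

  At a simple root of \<open>p\<^sub>2\<close> the equation can be solved for \<open>\<mu>\<^sub>j - d\<^sub>j\<close>, and the expansions follow by
  continuity (\<open>simple_root_first_order\<close>, \<open>simple_root_common\<close>). At a double root interlacing makes \<open>p\<^sub>1\<close>
  vanish as well, the deviations \<open>\<mu> - d\<close> have order \<open>r\<close>, and the sum and product of the two rescaled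
  deviations converge to those of \<open>\<kappa>\<^sub>+\<close> and \<open>\<kappa>\<^sub>-\<close>; hence so do the deviations themselves, after a swap
  depending on \<open>r\<close> (\<open>double_root_splitting\<close>). Strict hyperbolicity of \<open>P\<^sub>m\<^sub>-\<^sub>1\<close> together with interlacing excludes
  triple roots of \<open>p\<^sub>2\<close>, so these cases are exhaustive (\<open>ray_labelling\<close>).

  The same persistence theorem at \<open>\<xi> = 0\<close>, where \<open>Q\<^sub>2(\<lambda>, 0) = \<lambda>\<^sup>m\<^sup>-\<^sup>2 (\<lambda>\<^sup>2 + c\<^sub>1 \<lambda> + c\<^sub>2)\<close> and \<open>c\<^sub>2 \<noteq> 0\<close>, yields a labelling
  of all \<open>m\<close> roots that is continuous at \<open>0\<close>. On each ray, for small \<open>r\<close>, the \<open>m - 2\<close> roots that it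
  sends to \<open>0\<close> are the numbers \<open>\<i> r \<mu>\<^sub>j\<close>, and they are relabelled accordingly. A permutation of roots that all tend to
  \<open>0\<close> does not affect continuity at \<open>0\<close>; this is why expansions obtained ray by ray suffice.
\<close>

section \<open>Roots of a converging family of polynomials\<close>

text \<open>
  Compare \<open>p b\<close> and \<open>p k\<close> factor by factor: if every root is at distance at least \<open>|b - k|\<close> from
  \<open>k\<close>, then \<open>|b - z| \<le> 2 |k - z|\<close> for every root \<open>z\<close>. Read the other way round, a polynomial that is
  much smaller at \<open>k\<close> than at a nearby point \<open>b\<close> has a root close to \<open>k\<close>. The comparison involves the
  quotient \<open>p b / p k\<close> only, so it survives when the leading coefficient tends to \<open>0\<close>.
\<close>

lemma norm_poly_le_far_roots:
  fixes p :: "complex poly"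
  assumes far: "\<And>z. poly p z = 0 \<Longrightarrow> norm (b - k) \<le> norm (k - z)"
  shows "norm (poly p b) \<le> 2 ^ degree p * norm (poly p k)"
proof -
  obtain root where p: "smult (lead_coeff p) (\<Prod>i<degree p. [:- root i, 1:]) = p"
    by (rule complex_poly_decompose')
  have val: "norm (poly p x) = norm (lead_coeff p) * (\<Prod>i<degree p. norm (x - root i))" for x
    by (subst p [symmetric]) (simp add: poly_prod norm_mult prod_norm [symmetric])
  have "norm (b - root i) \<le> 2 * norm (k - root i)" if "i < degree p" for i
  proof -
    have "poly p (root i) = 0"
      using that by (subst p [symmetric]) (auto simp: poly_prod)
    from far [OF this] show ?thesis
      using norm_triangle_ineq [of "b - k" "k - root i"] by simp
  qed
  then have "(\<Prod>i<degree p. norm (b - root i)) \<le> (\<Prod>i<degree p. 2 * norm (k - root i))"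
    by (intro prod_mono) auto
  also have "\<dots> = 2 ^ degree p * (\<Prod>i<degree p. norm (k - root i))"
    by (simp add: prod.distrib)
  finally show ?thesis
    unfolding val by (metis mult.left_commute mult_left_mono norm_ge_zero)
qed

text \<open>
  Coefficientwise convergence with a common bound on the degrees. Degrees may drop in the limit; this
  is the situation on a ray, where the leading coefficient tends to \<open>0\<close>.
\<close>

definition coeffs_tendsto ::
    "('a \<Rightarrow> 'b::{real_normed_field} poly) \<Rightarrow> 'b poly \<Rightarrow> 'a filter \<Rightarrow> bool"
  where "coeffs_tendsto f g F \<longleftrightarrow>
    (\<exists>N. degree g \<le> N \<and> (\<forall>x. degree (f x) \<le> N)) \<and>
    (\<forall>n. ((\<lambda>x. coeff (f x) n) \<longlongrightarrow> coeff g n) F)"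

lemma coeffs_tendstoI:
  assumes "degree g \<le> N" "\<And>x. degree (f x) \<le> N"
    "\<And>n. ((\<lambda>x. coeff (f x) n) \<longlongrightarrow> coeff g n) F"
  shows "coeffs_tendsto f g F"
  using assms unfolding coeffs_tendsto_def by blast

lemma coeffs_tendsto_coeff:
  "coeffs_tendsto f g F \<Longrightarrow> ((\<lambda>x. coeff (f x) n) \<longlongrightarrow> coeff g n) F"
  by (simp add: coeffs_tendsto_def)

lemma coeffs_tendsto_const: "coeffs_tendsto (\<lambda>_. g) g F"
  by (auto simp: coeffs_tendsto_def)

lemma coeffs_tendsto_linear:
  assumes "(a \<longlongrightarrow> k) F"
  shows "coeffs_tendsto (\<lambda>x. [:- a x, 1:]) [:- k, 1:] F"
  by (rule coeffs_tendstoI [where N = 1])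
     (auto simp: coeff_pCons split: nat.splits intro: tendsto_minus assms)

lemma coeffs_tendsto_add:
  assumes "coeffs_tendsto f g F" "coeffs_tendsto f' g' F"
  shows "coeffs_tendsto (\<lambda>x. f x + f' x) (g + g') F"
proof -
  obtain N N' where N: "degree g \<le> N" "\<And>x. degree (f x) \<le> N" "degree g' \<le> N'" "\<And>x. degree (f' x) \<le> N'"
    using assms unfolding coeffs_tendsto_def by blast
  show ?thesis
    by (rule coeffs_tendstoI [where N = "max N N'"])
       (auto intro!: degree_add_le tendsto_add coeffs_tendsto_coeff assms
          intro: N [THEN le_max_iff_disj [THEN iffD2, OF disjI1]] N [THEN le_max_iff_disj [THEN iffD2, OF disjI2]])
qed

lemma coeffs_tendsto_smult:
  assumes "coeffs_tendsto f g F" "(c \<longlongrightarrow> k) F"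
  shows "coeffs_tendsto (\<lambda>x. smult (c x) (f x)) (smult k g) F"
proof -
  obtain N where N: "degree g \<le> N" "\<And>x. degree (f x) \<le> N"
    using assms unfolding coeffs_tendsto_def by blast
  then show ?thesis
    by (intro coeffs_tendstoI [where N = N])
       (auto intro!: tendsto_mult coeffs_tendsto_coeff assms intro: order_trans [OF degree_smult_le])
qed

lemma coeffs_tendsto_mult:
  assumes "coeffs_tendsto f g F" "coeffs_tendsto f' g' F"
  shows "coeffs_tendsto (\<lambda>x. f x * f' x) (g * g') F"
proof -
  obtain N N' where "degree g \<le> N" "\<And>x. degree (f x) \<le> N" "degree g' \<le> N'" "\<And>x. degree (f' x) \<le> N'"
    using assms unfolding coeffs_tendsto_def by blast
  then show ?thesis
    by (intro coeffs_tendstoI [where N = "N + N'"])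
       (auto simp: coeff_mult
          intro!: tendsto_sum tendsto_mult coeffs_tendsto_coeff assms order_trans [OF degree_mult_le] add_mono)
qed

lemma coeffs_tendsto_prod:
  assumes "finite I" "\<And>i. i \<in> I \<Longrightarrow> coeffs_tendsto (f i) (g i) F"
  shows "coeffs_tendsto (\<lambda>x. \<Prod>i\<in>I. f i x) (\<Prod>i\<in>I. g i) F"
  using assms by (induction rule: finite_induct) (auto intro: coeffs_tendsto_const coeffs_tendsto_mult)

lemma coeffs_tendsto_pderiv:
  assumes "coeffs_tendsto f g F"
  shows "coeffs_tendsto (\<lambda>x. pderiv (f x)) (pderiv g) F"
proof -
  obtain N where N: "degree g \<le> N" "\<And>x. degree (f x) \<le> N"
    using assms unfolding coeffs_tendsto_def by blast
  have "degree (pderiv g) \<le> N" "degree (pderiv (f x)) \<le> N" for x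
    using N(1) N(2) [of x] by (simp_all add: degree_pderiv)
  then show ?thesis
    by (intro coeffs_tendstoI [where N = N])
       (auto simp: coeff_pderiv intro!: tendsto_mult coeffs_tendsto_coeff assms)
qed

lemma poly_eq_sum_atMost:
  fixes p :: "'a::comm_ring_1 poly"
  assumes "degree p \<le> N"
  shows "poly p x = (\<Sum>i\<le>N. coeff p i * x ^ i)"
  by (subst poly_as_sum_of_monoms' [OF assms, symmetric]) (simp add: poly_sum poly_monom)

lemma coeffs_tendsto_poly:
  assumes "coeffs_tendsto f g F" "(z \<longlongrightarrow> w) F"
  shows "((\<lambda>x. poly (f x) (z x)) \<longlongrightarrow> poly g w) F"
proof -
  obtain N where N: "degree g \<le> N" "\<And>x. degree (f x) \<le> N"
    using assms(1) unfolding coeffs_tendsto_def by blast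
  show ?thesis
    unfolding poly_eq_sum_atMost [OF N(1)] poly_eq_sum_atMost [OF N(2)]
    by (intro tendsto_intros coeffs_tendsto_coeff assms)
qed

lemma tendsto_poly_arg:
  fixes p :: "'b::real_normed_field poly"
  assumes "(z \<longlongrightarrow> w) F"
  shows "((\<lambda>x. poly p (z x)) \<longlongrightarrow> poly p w) F"
  using coeffs_tendsto_poly [OF coeffs_tendsto_const assms] .

text \<open>
  The zero polynomial, for which every number is a root, is included.
\<close>

lemma nearest_root_exists:
  fixes p :: "complex poly"
  assumes "poly p z = 0"
  shows "\<exists>r. poly p r = 0 \<and> (\<forall>w. poly p w = 0 \<longrightarrow> norm (r - k) \<le> norm (w - k))"
proof (cases "p = 0")
  case False
  define r where "r = arg_min_on (\<lambda>w. norm (w - k)) {w. poly p w = 0}"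
  have fin: "finite {w. poly p w = 0}" "{w. poly p w = 0} \<noteq> {}"
    using False assms by (auto intro: poly_roots_finite)
  from arg_min_if_finite [OF this, of "\<lambda>w. norm (w - k)"] show ?thesis
    unfolding r_def [symmetric] by (auto simp: not_less)
qed (auto intro!: exI [of _ k])

text \<open>
  Near a root \<open>k\<close> of the limit \<open>g\<close> there are points \<open>b\<close> with \<open>g b \<noteq> 0\<close>, whereas \<open>f\<^sub>x k\<close> tends to \<open>0\<close>.
  So \<open>norm_poly_le_far_roots\<close> forces \<open>f\<^sub>x\<close> to have a root within any given distance of \<open>k\<close>, and
  hence the root nearest to \<open>k\<close> converges to \<open>k\<close>.
\<close>

lemma nearest_root_tendsto:
  fixes f :: "'a \<Rightarrow> complex poly"
  assumes conv: "coeffs_tendsto f g F" and g: "g \<noteq> 0" "poly g k = 0"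
  obtains \<rho> where "(\<rho> \<longlongrightarrow> k) F" "\<forall>\<^sub>F x in F. poly (f x) (\<rho> x) = 0"
proof -
  define \<rho> where "\<rho> x = (SOME r. poly (f x) r = 0 \<and>
      (\<forall>w. poly (f x) w = 0 \<longrightarrow> norm (r - k) \<le> norm (w - k)))" for x
  have \<rho>: "poly (f x) (\<rho> x) = 0 \<and> norm (\<rho> x - k) \<le> norm (w - k)" if "poly (f x) w = 0" for x w
    using someI_ex [OF nearest_root_exists [OF that, of k], folded \<rho>_def] that by blast
  obtain N where N: "\<And>x. degree (f x) \<le> N"
    using conv unfolding coeffs_tendsto_def by blast
  have near: "\<forall>\<^sub>F x in F. \<exists>w. poly (f x) w = 0 \<and> norm (w - k) < e" if "e > 0" for e
  proof -
    have "\<not> ball k e \<subseteq> {w. poly g w = 0}"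
      using poly_roots_finite [OF g(1)] finite_subset countable_finite uncountable_ball [OF that, of k]
      by blast
    then obtain b where "b \<in> ball k e" and b: "poly g b \<noteq> 0"
      by blast
    then have bk: "norm (b - k) < e"
      by (simp add: dist_norm norm_minus_commute)
    have "((\<lambda>x. 2 ^ N * norm (poly (f x) k) - norm (poly (f x) b)) \<longlongrightarrow>
        2 ^ N * norm (poly g k) - norm (poly g b)) F"
      by (intro tendsto_intros coeffs_tendsto_poly [OF conv])
    then have "\<forall>\<^sub>F x in F. 2 ^ N * norm (poly (f x) k) - norm (poly (f x) b) < 0"
      by (rule order_tendstoD) (use b g in simp)
    then show ?thesis
    proof eventually_elim
      case (elim x)
      have "(2::real) ^ degree (f x) \<le> 2 ^ N"
        using N by (intro power_increasing) auto
      then have "\<not> norm (poly (f x) b) \<le> 2 ^ degree (f x) * norm (poly (f x) k)"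
        using elim mult_right_mono [of "2 ^ degree (f x)" "2 ^ N" "norm (poly (f x) k)"] by fastforce
      then obtain z where "poly (f x) z = 0" "norm (k - z) < norm (b - k)"
        using norm_poly_le_far_roots [of "f x" b k] not_le by blast
      with bk show ?case
        by (intro exI [of _ z]) (auto simp: norm_minus_commute)
    qed
  qed
  show ?thesis
  proof
    show "(\<rho> \<longlongrightarrow> k) F"
    proof (rule tendstoI)
      fix e :: real assume "e > 0"
      from near [OF this] show "\<forall>\<^sub>F x in F. dist (\<rho> x) k < e"
        by eventually_elim (use \<rho> in \<open>force simp: dist_norm\<close>)
    qed
    show "\<forall>\<^sub>F x in F. poly (f x) (\<rho> x) = 0"
      using near [of 1] by (auto elim!: eventually_mono dest: \<rho>)
  qed
qed

lemma coeff_synthetic_div: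
  fixes p :: "'a::comm_ring_1 poly"
  shows "coeff (synthetic_div p c) n = coeff p (Suc n) + c * coeff (synthetic_div p c) (Suc n)"
  using arg_cong [OF synthetic_div_correct [of p c], of "\<lambda>q. coeff q (Suc n)"] by simp

text \<open>
  The coefficients of a synthetic quotient obey a recursion that descends from the common degree bound,
  so convergence passes down from the top coefficient.
\<close>

lemma coeffs_tendsto_synthetic_div:
  assumes conv: "coeffs_tendsto f g F" and c: "(c \<longlongrightarrow> k) F"
  shows "coeffs_tendsto (\<lambda>x. synthetic_div (f x) (c x)) (synthetic_div g k) F"
proof -
  obtain N where N: "degree g \<le> N" "\<And>x. degree (f x) \<le> N"
    using conv unfolding coeffs_tendsto_def by blast
  have deg: "degree (synthetic_div g k) \<le> N" "degree (synthetic_div (f x) (c x)) \<le> N" for x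
    using N(1) N(2) [of x] by (auto simp: degree_synthetic_div)
  have "((\<lambda>x. coeff (synthetic_div (f x) (c x)) n) \<longlongrightarrow> coeff (synthetic_div g k) n) F"
    if "Suc N - n = i" for i n
    using that
  proof (induction i arbitrary: n)
    case 0
    then have "N < n" by simp
    with deg have "coeff (synthetic_div g k) n = 0" "coeff (synthetic_div (f x) (c x)) n = 0" for x
      by (auto intro!: coeff_eq_0 intro: le_less_trans)
    then show ?case by simp
  next
    case (Suc i)
    show ?case
      by (subst (1 2) coeff_synthetic_div)
         (intro tendsto_intros coeffs_tendsto_coeff [OF conv] c Suc.IH, use Suc.prems in simp)
  qed
  with deg show ?thesis
    by (intro coeffs_tendstoI [where N = N]) auto
qed

lemma split_off_root:
  fixes f :: "'a \<Rightarrow> complex poly"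
  assumes conv: "coeffs_tendsto f (g * [:- k, 1:]) F" and g: "g \<noteq> 0"
  obtains \<rho> h where "(\<rho> \<longlongrightarrow> k) F" "coeffs_tendsto h g F"
    "\<forall>\<^sub>F x in F. f x = h x * [:- \<rho> x, 1:]"
proof -
  have "g * [:- k, 1:] \<noteq> 0"
    using g no_zero_divisors [of g "[:- k, 1:]"] by auto
  then obtain \<rho> where \<rho>: "(\<rho> \<longlongrightarrow> k) F" and root: "\<forall>\<^sub>F x in F. poly (f x) (\<rho> x) = 0"
    by (rule nearest_root_tendsto [OF conv, of k]) auto
  have "coeffs_tendsto (\<lambda>x. synthetic_div (f x) (\<rho> x)) (synthetic_div (g * [:- k, 1:]) k) F"
    by (rule coeffs_tendsto_synthetic_div [OF conv \<rho>])
  moreover have "synthetic_div (g * [:- k, 1:]) k = g"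
    using synthetic_div_unique [of "g * [:- k, 1:]" k g 0] by simp
  moreover have "\<forall>\<^sub>F x in F. f x = synthetic_div (f x) (\<rho> x) * [:- \<rho> x, 1:]"
    using root by eventually_elim
      (metis synthetic_div_correct' add.right_neutral mult.commute pCons_0_0)
  ultimately show ?thesis
    using that \<rho> by metis
qed

text \<open>
  Convergent roots can be split off one at a time because the cofactor converges again. Since
  each root is divided out before the next one is sought, multiplicities are accounted for.
\<close>

lemma split_off_roots:
  fixes f :: "'a \<Rightarrow> complex poly" and k :: "'i \<Rightarrow> complex"
  assumes "finite I" "coeffs_tendsto f (g * (\<Prod>i\<in>I. [:- k i, 1:])) F" "g \<noteq> 0"
  shows "\<exists>\<rho> h. (\<forall>i\<in>I. (\<rho> i \<longlongrightarrow> k i) F) \<and> coeffs_tendsto h g F \<and>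
    (\<forall>\<^sub>F x in F. f x = h x * (\<Prod>i\<in>I. [:- \<rho> i x, 1:]))"
  using assms
proof (induction I arbitrary: f rule: finite_induct)
  case empty
  then show ?case by auto
next
  case (insert i I)
  have "coeffs_tendsto f ((g * (\<Prod>i\<in>I. [:- k i, 1:])) * [:- k i, 1:]) F"
    using insert.prems(1) unfolding prod.insert [OF insert.hyps] mult.assoc
    by (subst (2) mult.commute)
  moreover have "g * (\<Prod>i\<in>I. [:- k i, 1:]) \<noteq> 0"
    using insert by auto
  ultimately obtain r h where r: "(r \<longlongrightarrow> k i) F" "coeffs_tendsto h (g * (\<Prod>i\<in>I. [:- k i, 1:])) F"
      "\<forall>\<^sub>F x in F. f x = h x * [:- r x, 1:]"
    by (rule split_off_root)
  from insert.IH [OF r(2) insert.prems(2)] obtain \<rho> h' where h':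
      "\<And>j. j \<in> I \<Longrightarrow> (\<rho> j \<longlongrightarrow> k j) F" "coeffs_tendsto h' g F"
      "\<forall>\<^sub>F x in F. h x = h' x * (\<Prod>i\<in>I. [:- \<rho> i x, 1:])"
    by blast
  have "\<forall>\<^sub>F x in F. f x = h' x * (\<Prod>j\<in>insert i I. [:- (\<rho>(i := r)) j x, 1:])"
    using r(3) h'(3)
  proof eventually_elim
    case (elim x)
    have "(\<Prod>j\<in>I. [:- (\<rho>(i := r)) j x, 1:]) = (\<Prod>j\<in>I. [:- \<rho> j x, 1:])"
      using insert.hyps by (intro prod.cong) auto
    with elim show ?case
      unfolding prod.insert [OF insert.hyps] by (simp only: fun_upd_same mult_ac)
  qed
  with h' r(1) show ?case
    by (intro exI [of _ "\<rho>(i := r)"] exI [of _ h']) auto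
qed

text \<open>
  Two numbers whose sum and product converge converge themselves after a suitable swap:
  \<open>|z\<^sub>1 - a| |z\<^sub>1 - b|\<close> tends to \<open>0\<close>, so the one closer to \<open>z\<^sub>1\<close> converges to \<open>z\<^sub>1\<close>, and the sum determines the
  limit of the other. This covers \<open>z\<^sub>1 = z\<^sub>2\<close> too.
\<close>

lemma pair_tendsto_of_sum_prod:
  fixes a b :: "'a \<Rightarrow> complex"
  assumes sum: "((\<lambda>x. a x + b x) \<longlongrightarrow> z1 + z2) F" and prod: "((\<lambda>x. a x * b x) \<longlongrightarrow> z1 * z2) F"
  obtains sw where "((\<lambda>x. if sw x then b x else a x) \<longlongrightarrow> z1) F"
    "((\<lambda>x. if sw x then a x else b x) \<longlongrightarrow> z2) F"
proof -
  define sw where "sw x \<longleftrightarrow> norm (b x - z1) < norm (a x - z1)" for x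
  let ?c = "\<lambda>x. if sw x then b x else a x"
  have "((\<lambda>x. z1\<^sup>2 - z1 * (a x + b x) + a x * b x) \<longlongrightarrow> z1\<^sup>2 - z1 * (z1 + z2) + z1 * z2) F"
    by (intro tendsto_intros sum prod)
  then have "((\<lambda>x. norm ((a x - z1) * (b x - z1))) \<longlongrightarrow> 0) F"
    by (intro tendsto_norm_zero) (simp add: algebra_simps power2_eq_square)
  then have sq: "((\<lambda>x. (norm (?c x - z1))\<^sup>2) \<longlongrightarrow> 0) F"
  proof (rule tendsto_sandwich [rotated 3])
    show "\<forall>\<^sub>F x in F. (norm (?c x - z1))\<^sup>2 \<le> norm ((a x - z1) * (b x - z1))"
      by (rule always_eventually)
         (auto simp: sw_def norm_mult power2_eq_square intro: mult_mono)
  qed (auto intro: tendsto_const)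
  have "((\<lambda>x. sqrt ((norm (?c x - z1))\<^sup>2)) \<longlongrightarrow> sqrt 0) F"
    by (intro tendsto_real_sqrt sq)
  then have c: "(?c \<longlongrightarrow> z1) F"
    by (subst (asm) real_sqrt_abs) (simp add: tendsto_norm_zero_iff LIM_zero_iff)
  moreover have "((\<lambda>x. a x + b x - ?c x) \<longlongrightarrow> z1 + z2 - z1) F"
    by (intro tendsto_diff sum c)
  then have "((\<lambda>x. if sw x then a x else b x) \<longlongrightarrow> z2) F"
    by (auto elim!: Lim_transform_eventually simp: if_distrib)
  ultimately show ?thesis
    using that by blast
qed
lemma tendsto_if_same:
  assumes "(f \<longlongrightarrow> l) F" "(g \<longlongrightarrow> l) F"
  shows "((\<lambda>x. if P x then f x else g x) \<longlongrightarrow> l) F"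
proof (rule topological_tendstoI)
  fix S assume "open S" "l \<in> S"
  with assms have "\<forall>\<^sub>F x in F. f x \<in> S" "\<forall>\<^sub>F x in F. g x \<in> S"
    by (blast dest: topological_tendstoD)+
  then show "\<forall>\<^sub>F x in F. (if P x then f x else g x) \<in> S"
    by eventually_elim auto
qed

lemma proots_prod_linear:
  assumes "finite I"
  shows "proots (\<Prod>j\<in>I. [:- f j, 1:]) = image_mset f (mset_set I)"
  by (subst proots_prod) (auto simp: sum_unfold_sum_mset)

lemma mset_as_image:
  assumes "size M = m"
  shows "\<exists>e. M = image_mset e (mset_set {1..m})"
proof -
  obtain xs where xs: "mset xs = M" using ex_mset by blast
  have "mset xs = image_mset (\<lambda>i. xs ! i) (mset_set {0..<m})"
    using assms xs by (metis map_nth mset_map mset_set_upto_eq_mset_upto mset_upt size_mset)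
  also have "mset_set {0..<m} = image_mset (\<lambda>j. j - 1) (mset_set {1..m})"
    by (subst image_mset_mset_set) (auto simp: inj_on_def image_def intro!: arg_cong [of _ _ mset_set] bexI [of _ "Suc _"])
  finally show ?thesis
    using xs by (auto simp: multiset.map_comp)
qed

text \<open>
  The convergent roots exist only near \<open>a\<close>, so elsewhere an arbitrary enumeration of the roots is used.
  Convergence is along \<open>nhds a\<close>, which includes the point \<open>a\<close> itself and so fixes the labels there.
\<close>

lemma continuous_root_labelling:
  fixes Q :: "'a::topological_space \<Rightarrow> complex poly"
  assumes conv: "coeffs_tendsto Q (\<Prod>j\<in>{1..m}. [:- l j, 1:]) (nhds a)"
    and deg: "\<And>x. degree (Q x) = m" "\<And>x. Q x \<noteq> 0"
  obtains L where "\<And>x. proots (Q x) = image_mset (\<lambda>j. L j x) (mset_set {1..m})"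
    "\<And>j. j \<in> {1..m} \<Longrightarrow> (L j \<longlongrightarrow> l j) (nhds a)"
proof -
  have "coeffs_tendsto Q (1 * (\<Prod>j\<in>{1..m}. [:- l j, 1:])) (nhds a)"
    using conv by simp
  from split_off_roots [OF _ this] obtain \<rho> h where
    \<rho>: "\<And>j. j \<in> {1..m} \<Longrightarrow> (\<rho> j \<longlongrightarrow> l j) (nhds a)" and
    fact: "\<forall>\<^sub>F x in nhds a. Q x = h x * (\<Prod>j\<in>{1..m}. [:- \<rho> j x, 1:])"
    using finite_atLeastAtMost one_neq_zero by blast
  have ev: "\<forall>\<^sub>F x in nhds a. proots (Q x) = image_mset (\<lambda>j. \<rho> j x) (mset_set {1..m})"
    using fact
  proof eventually_elim
    case (elim x)
    let ?P = "\<Prod>j\<in>{1..m}. [:- \<rho> j x, 1:]"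
    have P: "?P \<noteq> 0" by simp
    moreover have h: "h x \<noteq> 0" using elim deg(2) [of x] by auto
    ultimately have "m = degree (h x) + degree ?P"
      using degree_mult_eq [of "h x" ?P] elim deg(1) [of x] by simp
    moreover have "degree ?P = m"
      by (simp add: degree_prod_sum_eq)
    ultimately have "degree (h x) = 0" by simp
    then have "proots (h x) = {#}"
      by (auto elim!: degree_eq_zeroE)
    with elim show ?case
      using proots_mult [OF h P] proots_prod_linear [of "{1..m}" "\<lambda>j. \<rho> j x"] by simp
  qed
  have "\<forall>x. \<exists>e. proots (Q x) = image_mset e (mset_set {1..m})"
    using mset_as_image size_proots_complex deg(1) by metis
  then obtain e where e: "\<And>x. proots (Q x) = image_mset (e x) (mset_set {1..m})"
    by metis
  define pick where "pick x = (if proots (Q x) = image_mset (\<lambda>j. \<rho> j x) (mset_set {1..m})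
    then (\<lambda>j. \<rho> j x) else e x)" for x
  define L where "L j x = pick x j" for j x
  show ?thesis
  proof
    show "proots (Q x) = image_mset (\<lambda>j. L j x) (mset_set {1..m})" for x
    proof (cases "proots (Q x) = image_mset (\<lambda>j. \<rho> j x) (mset_set {1..m})")
      case True
      then show ?thesis
        unfolding L_def pick_def if_P [OF True] .
    next
      case False
      show ?thesis
        unfolding L_def pick_def if_not_P [OF False] using e [of x] .
    qed
    fix j assume "j \<in> {1..m}"
    have "\<forall>\<^sub>F x in nhds a. \<rho> j x = L j x"
      using ev by eventually_elim (simp add: L_def pick_def)
    with \<rho> [OF \<open>j \<in> {1..m}\<close>] show "(L j \<longlongrightarrow> l j) (nhds a)"
      by (rule Lim_transform_eventually)
  qed
qed

text \<open>
  Roots that tend to \<open>0\<close> cannot coincide with roots that stay away from \<open>0\<close>; a multiset of the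
  right size is then forced to consist of all the small roots.
\<close>

lemma small_roots_eq:
  fixes s L :: "nat \<Rightarrow> real \<Rightarrow> complex"
  assumes sub: "\<forall>\<^sub>F r in F. image_mset (\<lambda>j. s j r) (mset_set {1..k}) \<subseteq>#
      image_mset (\<lambda>j. L j r) (mset_set {1..Suc (Suc k)})"
    and s: "\<And>j. j \<in> {1..k} \<Longrightarrow> (s j \<longlongrightarrow> 0) F"
    and L: "(L (Suc k) \<longlongrightarrow> a) F" "(L (Suc (Suc k)) \<longlongrightarrow> b) F" and ab: "a \<noteq> 0" "b \<noteq> 0"
  shows "\<forall>\<^sub>F r in F. image_mset (\<lambda>j. s j r) (mset_set {1..k}) = image_mset (\<lambda>j. L j r) (mset_set {1..k})"
proof -
  have ne: "\<forall>\<^sub>F r in F. s j r \<noteq> f r" if "j \<in> {1..k}" "(f \<longlongrightarrow> c) F" "c \<noteq> 0" for j f c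
  proof -
    have "\<forall>\<^sub>F r in F. f r - s j r \<noteq> 0"
      by (rule tendsto_imp_eventually_ne [OF tendsto_diff [OF that(2) s [OF that(1)]]]) (use that in simp)
    then show ?thesis by eventually_elim auto
  qed
  have "\<forall>\<^sub>F r in F. \<forall>j\<in>{1..k}. s j r \<noteq> L (Suc k) r" "\<forall>\<^sub>F r in F. \<forall>j\<in>{1..k}. s j r \<noteq> L (Suc (Suc k)) r"
    by (intro eventually_ball_finite ballI ne [OF _ L(1) ab(1)] ne [OF _ L(2) ab(2)]; simp)+
  with sub show ?thesis
  proof eventually_elim
    case (elim r)
    let ?A = "image_mset (\<lambda>j. s j r) (mset_set {1..k})" and ?B = "image_mset (\<lambda>j. L j r) (mset_set {1..k})"
    have "{1..Suc (Suc k)} = insert (Suc k) (insert (Suc (Suc k)) {1..k})" by auto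
    with elim(1) have "?A \<subseteq># ?B + {#L (Suc k) r, L (Suc (Suc k)) r#}"
      by simp
    then have "?A - {#L (Suc k) r, L (Suc (Suc k)) r#} \<subseteq># ?B"
      by (simp only: subset_eq_diff_conv)
    moreover have "?A - {#L (Suc k) r, L (Suc (Suc k)) r#} = ?A"
    proof -
      have "L (Suc k) r \<notin># ?A" "L (Suc (Suc k)) r \<notin># ?A"
        using elim(2,3) by force+
      then show ?thesis
        by (simp add: minus_add_mset_if_not_in_lhs)
    qed
    ultimately show ?case
      by (metis mset_subset_size nat_less_le size_image_mset subset_mset.less_le)
  qed
qed

section \<open>Symbols along a ray\<close>

lemma coeff_symbol:
  "coeff (symbol r P \<xi>) n =
    (\<Sum>(k, \<alpha>)\<in>indices r. if k = n then of_real (P k \<alpha>) * (\<Prod>i\<in>UNIV. \<xi> $ i ^ \<alpha> i) else 0)"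
  unfolding symbol_def by (simp add: coeff_sum case_prod_unfold)

lemma degree_symbol_le: "degree (symbol r P \<xi>) \<le> r"
  by (rule degree_le) (auto simp: coeff_symbol indices_def intro!: sum.neutral)

lemma coeff_symbol_top:
  fixes P :: "'n::finite coeffs"
  shows "coeff (symbol r P \<xi>) r = of_real (P r (\<lambda>_. 0))"
proof -
  have "coeff (symbol r P \<xi>) r =
      (\<Sum>x\<in>(indices r :: (nat \<times> ('n \<Rightarrow> nat)) set). if x = (r, \<lambda>_. 0) then of_real (P r (\<lambda>_. 0)) else 0)"
    unfolding coeff_symbol
  proof (rule sum.cong [OF refl], clarify)
    fix k and \<alpha> :: "'n \<Rightarrow> nat"
    assume "(k, \<alpha>) \<in> indices r"
    then have "k = r \<longleftrightarrow> \<alpha> = (\<lambda>_. 0)"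
      by (auto simp: indices_def fun_eq_iff)
    then show "(if k = r then of_real (P k \<alpha>) * (\<Prod>i\<in>UNIV. \<xi> $ i ^ \<alpha> i) else 0) =
        (if (k, \<alpha>) = (r, \<lambda>_. 0) then of_real (P r (\<lambda>_. 0)) else 0)"
      by auto
  qed
  also have "\<dots> = of_real (P r (\<lambda>_. 0))"
    by (subst sum.delta [OF finite_indices]) (simp add: indices_def)
  finally show ?thesis .
qed

lemma symbol_0: "symbol r P 0 = monom (of_real (P r (\<lambda>_. 0))) r"
proof (rule poly_eqI)
  fix n
  show "coeff (symbol r P 0) n = coeff (monom (of_real (P r (\<lambda>_. 0))) r :: 'a poly) n"
  proof (cases "n = r")
    case True
    then show ?thesis by (simp add: coeff_symbol_top)
  next
    case False
    have "(\<Prod>i\<in>UNIV. (0 :: 'a ^ 'b) $ i ^ \<alpha> i) = 0" if "(n, \<alpha>) \<in> indices r" for \<alpha>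
    proof -
      have "\<exists>i. \<alpha> i \<noteq> 0"
        using that False by (fastforce simp: indices_def)
      then show ?thesis by (auto simp: power_0_left)
    qed
    with False show ?thesis
      unfolding coeff_symbol by (auto intro!: sum.neutral)
  qed
qed

lemma coeffs_tendsto_symbol:
  assumes "(z \<longlongrightarrow> \<xi>) F"
  shows "coeffs_tendsto (\<lambda>x. symbol r P (z x)) (symbol r P \<xi>) F"
proof (rule coeffs_tendstoI [OF degree_symbol_le degree_symbol_le])
  fix n
  have "((\<lambda>x. if k = n then of_real (P k \<alpha>) * (\<Prod>i\<in>UNIV. z x $ i ^ \<alpha> i) else 0) \<longlongrightarrow>
      (if k = n then of_real (P k \<alpha>) * (\<Prod>i\<in>UNIV. \<xi> $ i ^ \<alpha> i) else 0)) F" for k \<alpha>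
    using assms by (auto intro!: tendsto_intros)
  then show "((\<lambda>x. coeff (symbol r P (z x)) n) \<longlongrightarrow> coeff (symbol r P \<xi>) n) F"
    unfolding coeff_symbol by (auto intro!: tendsto_sum)
qed

lemma times_ii_0: "times_ii 0 = 0"
  by (simp add: times_ii_def vec_eq_iff)

lemma tendsto_times_ii: "(z \<longlongrightarrow> \<xi>) F \<Longrightarrow> ((\<lambda>x. times_ii (z x)) \<longlongrightarrow> times_ii \<xi>) F"
  unfolding times_ii_def by (intro vec_tendstoI) (auto intro!: tendsto_intros)

abbreviation cpoly :: "real poly \<Rightarrow> complex poly" where "cpoly \<equiv> map_poly complex_of_real"

text \<open>
  This is homogeneity: \<open>P\<^sub>r(\<i> t \<mu>, \<i> t \<xi>) = (\<i> t)\<^sup>r P\<^sub>r(\<mu>, \<xi>)\<close>. It turns the symbol on a ray into a polynomial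
  with real coefficients in the rescaled variable \<open>\<mu>\<close>.
\<close>

lemma symbol_times_ii_scale:
  "symbol r P (times_ii (t *\<^sub>R \<xi>)) \<circ>\<^sub>p [:0, \<i> * of_real t:] =
    smult ((\<i> * of_real t) ^ r) (cpoly (symbol r P \<xi>))"
proof (rule poly_eqI)
  fix n
  let ?c = "\<i> * complex_of_real t"
  have "?c ^ n * (of_real (P n \<alpha>) * (\<Prod>i\<in>UNIV. times_ii (t *\<^sub>R \<xi>) $ i ^ \<alpha> i)) =
      ?c ^ r * of_real (of_real (P n \<alpha>) * (\<Prod>i\<in>UNIV. \<xi> $ i ^ \<alpha> i))"
    if "(n, \<alpha>) \<in> indices r" for \<alpha>
  proof -
    have "(\<Prod>i\<in>UNIV. times_ii (t *\<^sub>R \<xi>) $ i ^ \<alpha> i) = (\<Prod>i\<in>UNIV. ?c ^ \<alpha> i * of_real (\<xi> $ i) ^ \<alpha> i)"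
      by (intro prod.cong) (auto simp: times_ii_def power_mult_distrib)
    also have "\<dots> = ?c ^ (\<Sum>i\<in>UNIV. \<alpha> i) * of_real (\<Prod>i\<in>UNIV. \<xi> $ i ^ \<alpha> i)"
      by (simp add: prod.distrib power_sum)
    finally have "?c ^ n * (of_real (P n \<alpha>) * (\<Prod>i\<in>UNIV. times_ii (t *\<^sub>R \<xi>) $ i ^ \<alpha> i)) =
        ?c ^ (n + (\<Sum>i\<in>UNIV. \<alpha> i)) * (of_real (P n \<alpha>) * of_real (\<Prod>i\<in>UNIV. \<xi> $ i ^ \<alpha> i))"
      by (simp only: power_add mult_ac)
    also have "n + (\<Sum>i\<in>UNIV. \<alpha> i) = r"
      using that by (simp add: indices_def)
    finally show ?thesis by simp
  qed
  then show "coeff (symbol r P (times_ii (t *\<^sub>R \<xi>)) \<circ>\<^sub>p [:0, ?c:]) n =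
      coeff (smult (?c ^ r) (cpoly (symbol r P \<xi>))) n"
    unfolding coeff_pcompose_linear coeff_smult coeff_map_poly [of complex_of_real, OF of_real_0]
      coeff_symbol of_real_sum sum_distrib_left
    by (intro sum.cong) (simp_all only: split_paired_all prod.case if_distrib [of of_real]
        if_distrib [of "(*) _"] of_real_0 mult_zero_right split: if_split, blast)
qed

lemma proots_pcompose_scale:
  fixes p :: "complex poly"
  assumes c: "c \<noteq> 0"
  shows "image_mset ((*) c) (proots (p \<circ>\<^sub>p [:0, c:])) = proots p"
proof (cases "p = 0")
  case False
  have prod: "proots ((\<Prod>x\<in>#M. [:- x, 1:]) \<circ>\<^sub>p [:0, c:]) = image_mset (\<lambda>x. x / c) M" for M
  proof (induction M)
    case (add x M)
    have "(\<Prod>x\<in>#M. [:- x, 1:]) \<circ>\<^sub>p [:0, c:] \<noteq> 0"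
      using c by (subst pcompose_eq_0_iff) auto
    moreover have "[:- x, 1:] \<circ>\<^sub>p [:0, c:] = smult c [:- (x / c), 1:]"
      using c by (simp add: pcompose_pCons)
    ultimately show ?case
      using c add.IH by (simp add: pcompose_mult proots_mult del: mult_pCons_left smult_pCons)
  qed (simp add: pcompose_1)
  have "proots (p \<circ>\<^sub>p [:0, c:]) = image_mset (\<lambda>x. x / c) (proots p)"
    using False prod [of "proots p"]
    by (subst complex_poly_decompose_multiset [of p, symmetric]) (simp add: pcompose_smult)
  with c show ?thesis
    by (simp add: multiset.map_comp o_def)
qed simp

section \<open>Real-rooted and interlacing polynomials\<close>

lemma cpoly_mult: "cpoly (p * q) = cpoly p * cpoly q"
  by (rule poly_eqI) (simp add: coeff_map_poly coeff_mult)

lemma cpoly_linear [simp]: "cpoly [:- a, 1:] = [:- of_real a, 1:]"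
  by (simp add: map_poly_pCons)

lemma poly_cpoly_of_real [simp]: "poly (cpoly p) (of_real x) = of_real (poly p x)"
  by (induction p) (simp_all add: map_poly_pCons)

lemma real_rooted_nonzero: "real_rooted p \<Longrightarrow> p \<noteq> 0"
  by (metis complex_is_Real_iff imaginary_unit.sel(2) map_poly_0 poly_0 real_rooted_def zero_neq_one)

text \<open>
  Divide out all real roots. The remaining factor has no real root, and by the fundamental theorem
  of algebra a nonconstant one would have a complex root, which real-rootedness makes real.
\<close>

lemma real_rooted_decompose:
  assumes "real_rooted p"
  shows "p = smult (lead_coeff p) (\<Prod>x\<in>#proots p. [:- x, 1:])"
  using assms
proof (induction p rule: poly_root_order_induct)
  case 0
  then show ?case by simp
next
  case (no_roots p)
  have "degree p = 0"
  proof (rule ccontr)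
    assume "degree p \<noteq> 0"
    then have "\<not> constant (poly (cpoly p))"
      by (simp add: constant_degree degree_map_poly)
    then obtain z where z: "poly (cpoly p) z = 0"
      using fundamental_theorem_of_algebra by blast
    with no_roots.prems obtain a where "z = of_real a"
      by (auto simp: real_rooted_def elim: Reals_cases)
    with z no_roots show False by simp
  qed
  then show ?case
    by (auto elim!: degree_eq_zeroE)
next
  case (root p x n)
  have "real_rooted p"
    using root.prems by (auto simp: real_rooted_def cpoly_mult)
  note IH = root.IH [OF this]
  have "proots ([:- x, 1:] ^ n * p) = replicate_mset n x + proots p"
    using root.hyps by (subst proots_mult) (auto simp: proots_power)
  then show ?case
    by (subst IH) (simp add: lead_coeff_mult lead_coeff_power mult_ac)
qed

lemma degree_prod_linear: "degree (\<Prod>x\<in>#M. [:- x, 1:]) = size (M :: 'a::idom multiset)"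
proof (induction M)
  case (add x M)
  have "(\<Prod>x\<in>#M. [:- x, 1:]) \<noteq> 0"
    by auto
  with add show ?case
    by (simp add: degree_mult_eq del: mult_pCons_left)
qed simp

lemma real_rooted_length:
  assumes "real_rooted p"
  shows "length (real_roots p) = degree p"
proof -
  have "degree p = degree (\<Prod>x\<in>#proots p. [:- x, 1:])"
    using real_rooted_nonzero [OF assms]
    by (subst real_rooted_decompose [OF assms]) simp
  also have "\<dots> = size (proots p)"
    by (rule degree_prod_linear)
  finally show ?thesis
    by (metis mset_sorted_list_of_multiset real_roots_def size_mset)
qed

lemma prod_real_roots:
  assumes "real_rooted p"
  shows "p = smult (lead_coeff p) (\<Prod>j\<in>{1..degree p}. [:- nth_root p j, 1:])"
proof -
  have "(\<Prod>x\<in>#proots p. [:- x, 1:]) = (\<Prod>x\<leftarrow>real_roots p. [:- x, 1:])"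
    by (metis mset_map mset_sorted_list_of_multiset prod_mset_prod_list real_roots_def)
  also have "\<dots> = (\<Prod>i<degree p. [:- real_roots p ! i, 1:])"
    unfolding real_rooted_length [OF assms, symmetric]
    by (subst prod.list_conv_set_nth) (auto simp: atLeast0LessThan)
  also have "\<dots> = (\<Prod>j\<in>{1..degree p}. [:- nth_root p j, 1:])"
    by (rule prod.reindex_bij_witness [of _ "\<lambda>j. j - 1" Suc]) (auto simp: nth_root_def)
  finally show ?thesis
    using real_rooted_decompose [OF assms] by simp
qed

lemma nth_root_mono:
  assumes "real_rooted p" "1 \<le> i" "i \<le> j" "j \<le> degree p"
  shows "nth_root p i \<le> nth_root p j"
  using assms real_rooted_length [OF assms(1)]
  by (auto simp: nth_root_def real_roots_def intro!: sorted_nth_mono)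

lemma nth_root_strict_mono:
  assumes "real_rooted p" "distinct (real_roots p)" "1 \<le> i" "i < j" "j \<le> degree p"
  shows "nth_root p i < nth_root p j"
proof -
  have "nth_root p i \<noteq> nth_root p j"
    using assms real_rooted_length [OF assms(1)] by (simp add: nth_root_def nth_eq_iff_index_eq)
  with nth_root_mono [of p i j] assms show ?thesis by simp
qed

lemma cpoly_smult: "cpoly (smult c p) = smult (of_real c) (cpoly p)"
  by (rule poly_eqI) (simp add: coeff_map_poly)

lemma cpoly_prod: "cpoly (\<Prod>i\<in>I. f i) = (\<Prod>i\<in>I. cpoly (f i))"
  by (induction I rule: infinite_finite_induct) (simp_all add: cpoly_mult)

lemma cpoly_real_roots:
  assumes "real_rooted p"
  shows "cpoly p = smult (of_real (lead_coeff p)) (\<Prod>j\<in>{1..degree p}. [:- of_real (nth_root p j), 1:])"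
  by (subst prod_real_roots [OF assms]) (simp add: cpoly_smult cpoly_prod)

lemma poly_nth_root: 
  assumes "real_rooted p" "j \<in> {1..degree p}"
  shows "poly p (nth_root p j) = 0"
  using assms(2) by (subst prod_real_roots [OF assms(1)]) (auto simp: poly_prod)

lemma root_is_nth_root:
  assumes "real_rooted p" "poly p x = 0"
  obtains j where "j \<in> {1..degree p}" "x = nth_root p j"
proof -
  have "poly (smult (lead_coeff p) (\<Prod>j\<in>{1..degree p}. [:- nth_root p j, 1:])) x = 0"
    using assms prod_real_roots by metis
  then show ?thesis
    using real_rooted_nonzero [OF assms(1)] that by (auto simp: poly_prod)
qed

lemma omit_root_correct:
  assumes "real_rooted p" "j \<in> {1..degree p}"
  shows "p = [:- nth_root p j, 1:] * omit_root p j"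
  using poly_nth_root [OF assms] unfolding omit_root_def
  by (simp add: poly_eq_0_iff_dvd del: mult_pCons_left)

lemma omit_root2_eq:
  assumes "real_rooted p" "j \<in> {1..<degree p}"
  shows "omit_root2 p j = smult (lead_coeff p) (\<Prod>i\<in>{1..degree p} - {j, Suc j}. [:- nth_root p i, 1:])"
proof -
  let ?l = "\<lambda>i. [:- nth_root p i, 1:]"
  have "(\<Prod>i\<in>{1..degree p}. ?l i) = (\<Prod>i\<in>{1..degree p} - {j, Suc j}. ?l i) * (\<Prod>i\<in>{j, Suc j}. ?l i)"
    using assms(2) by (intro prod.subset_diff) auto
  then have "p = (?l j * ?l (j + 1)) * smult (lead_coeff p) (\<Prod>i\<in>{1..degree p} - {j, Suc j}. ?l i)"
    using prod_real_roots [OF assms(1)] by (simp add: mult_ac del: mult_pCons_left mult_pCons_right)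
  moreover have "?l j * ?l (j + 1) \<noteq> 0"
    by (metis one_neq_zero mult_eq_0_iff pCons_eq_0_iff)
  ultimately show ?thesis
    unfolding omit_root2_def by (metis nonzero_mult_div_cancel_left)
qed

section \<open>Expansion of a root of a perturbed polynomial\<close>

lemma tendsto_of_real_at_right_0: "(complex_of_real \<longlongrightarrow> 0) (at_right 0)"
  
  using tendsto_of_real [OF tendsto_ident_at [of "0::real" "{0<..}"]] by simp

text \<open>
  The equation reads \<open>(\<mu> - d) R(\<mu>) = - \<i> r p\<^sub>1(\<mu>) + r\<^sup>2 p\<^sub>0(\<mu>)\<close>; dividing by \<open>r R(\<mu>)\<close> exhibits \<open>(\<mu> - d) / r\<close> as a
  continuous expression in \<open>\<mu>\<close> and \<open>r\<close>.
\<close>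

lemma simple_root_first_order:
  fixes \<mu> :: "real \<Rightarrow> complex" and R p1 p0 :: "complex poly"
  assumes lim: "(\<mu> \<longlongrightarrow> d) (at_right 0)" and R: "poly R d \<noteq> 0"
    and root: "\<forall>\<^sub>F r in at_right 0. (\<mu> r - d) * poly R (\<mu> r)
      + \<i> * of_real r * poly p1 (\<mu> r) - (of_real r)\<^sup>2 * poly p0 (\<mu> r) = 0"
  shows "((\<lambda>r. \<i> * (\<mu> r - d) / of_real r) \<longlongrightarrow> poly p1 d / poly R d) (at_right 0)"
proof -
  have "((\<lambda>r. (poly p1 (\<mu> r) + \<i> * of_real r * poly p0 (\<mu> r)) / poly R (\<mu> r)) \<longlongrightarrow>
      (poly p1 d + \<i> * 0 * poly p0 d) / poly R d) (at_right 0)"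
    by (intro tendsto_intros tendsto_poly_arg lim tendsto_of_real_at_right_0 R)
  moreover have "\<forall>\<^sub>F r in at_right 0. poly R (\<mu> r) \<noteq> 0"
    using tendsto_poly_arg [OF lim] R by (rule tendsto_imp_eventually_ne)
  then have "\<forall>\<^sub>F r in at_right 0. (poly p1 (\<mu> r) + \<i> * of_real r * poly p0 (\<mu> r)) / poly R (\<mu> r)
      = \<i> * (\<mu> r - d) / of_real r"
    using root eventually_at_right_less
  proof eventually_elim
    case (elim r)
    then have "(\<mu> r - d) * poly R (\<mu> r) = (of_real r)\<^sup>2 * poly p0 (\<mu> r) - \<i> * of_real r * poly p1 (\<mu> r)"
      by (simp add: algebra_simps)
    then have "\<i> * (\<mu> r - d) * poly R (\<mu> r) =
        \<i> * ((of_real r)\<^sup>2 * poly p0 (\<mu> r) - \<i> * of_real r * poly p1 (\<mu> r))"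
      by (simp only: mult.assoc)
    with elim show ?case
      by (simp add: field_simps power2_eq_square)
  qed
  ultimately show ?thesis
    by (auto dest: Lim_transform_eventually)
qed

text \<open>
  If \<open>p\<^sub>1 = (\<lambda> - d) T\<close>, then \<open>(\<mu> - d) (R(\<mu>) + \<i> r T(\<mu>)) = r\<^sup>2 p\<^sub>0(\<mu>)\<close>. So \<open>\<mu> - d\<close> has order \<open>r\<^sup>2\<close>, the
  variation of \<open>p\<^sub>0\<close> and \<open>R\<close> between \<open>d\<close> and \<open>\<mu>\<close> is negligible at order \<open>r\<close>, and the only correction of
  that order to \<open>p\<^sub>0(d) / R(d)\<close> comes from \<open>\<i> r T\<close>.
\<close>

lemma simple_root_common:
  fixes \<mu> :: "real \<Rightarrow> complex" and R T p0 :: "complex poly"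
  assumes lim: "(\<mu> \<longlongrightarrow> d) (at_right 0)" and R: "poly R d \<noteq> 0"
    and root: "\<forall>\<^sub>F r in at_right 0. (\<mu> r - d) * poly R (\<mu> r)
      + \<i> * of_real r * ((\<mu> r - d) * poly T (\<mu> r)) - (of_real r)\<^sup>2 * poly p0 (\<mu> r) = 0"
  shows "((\<lambda>r. (\<i> * (\<mu> r - d) - \<i> * (of_real r)\<^sup>2 * (poly p0 d / poly R d)) / of_real r ^ 3) \<longlongrightarrow>
    poly p0 d * poly T d / (poly R d)\<^sup>2) (at_right 0)"
proof -
  define D where "D r = poly R (\<mu> r) + \<i> * of_real r * poly T (\<mu> r)" for r
  have D: "(D \<longlongrightarrow> poly R d + \<i> * 0 * poly T d) (at_right 0)"
    unfolding D_def by (intro tendsto_intros tendsto_poly_arg lim tendsto_of_real_at_right_0)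
  have D0: "\<forall>\<^sub>F r in at_right 0. D r \<noteq> 0"
    using D by (rule tendsto_imp_eventually_ne) (use R in simp)
  have u: "\<forall>\<^sub>F r in at_right 0. \<mu> r - d = (of_real r)\<^sup>2 * poly p0 (\<mu> r) / D r"
    using root D0 by eventually_elim (simp add: D_def field_simps)
  have "((\<lambda>r. of_real r * poly p0 (\<mu> r) / D r) \<longlongrightarrow> 0 * poly p0 d / (poly R d + \<i> * 0 * poly T d)) (at_right 0)"
    by (intro tendsto_intros tendsto_poly_arg lim tendsto_of_real_at_right_0 D) (use R in simp)
  moreover have "\<forall>\<^sub>F r in at_right 0. of_real r * poly p0 (\<mu> r) / D r = (\<mu> r - d) / of_real r"
    using u eventually_at_right_less by eventually_elim (simp add: power2_eq_square)
  ultimately have ur: "((\<lambda>r. (\<mu> r - d) / of_real r) \<longlongrightarrow> 0) (at_right 0)"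
    by (auto dest: Lim_transform_eventually)
  define S where "S p = synthetic_div p d" for p :: "complex poly"
  have S: "poly p z = poly p d + (z - d) * poly (S p) z" for p z
    using arg_cong [OF synthetic_div_correct' [of d p], of "\<lambda>q. poly q z"]
    by (simp add: S_def algebra_simps)
  \<comment> \<open>The quantity whose limit is sought, rewritten so that the small quotient \<open>(\<mu> - d) / r\<close> appears.\<close>
  let ?E = "\<lambda>r. (\<i> * ((\<mu> r - d) / of_real r * (poly (S p0) (\<mu> r) * poly R d - poly p0 d * poly (S R) (\<mu> r)))
      + poly p0 d * poly T (\<mu> r)) / (poly R d * D r)"
  have "(?E \<longlongrightarrow> (\<i> * (0 * (poly (S p0) d * poly R d - poly p0 d * poly (S R) d))
      + poly p0 d * poly T d) / (poly R d * (poly R d + \<i> * 0 * poly T d))) (at_right 0)"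
    by (intro tendsto_intros tendsto_poly_arg lim ur D) (use R in simp)
  moreover have "\<forall>\<^sub>F r in at_right 0.
      ?E r = (\<i> * (\<mu> r - d) - \<i> * (of_real r)\<^sup>2 * (poly p0 d / poly R d)) / of_real r ^ 3"
    using u D0 eventually_at_right_less
  proof eventually_elim
    case (elim r)
    define t where "t = complex_of_real r"
    have t: "t \<noteq> 0" using elim by (simp add: t_def)
    have num: "(\<mu> r - d) * (poly (S p0) (\<mu> r) * poly R d - poly p0 d * poly (S R) (\<mu> r))
        = poly p0 (\<mu> r) * poly R d - poly p0 d * poly R (\<mu> r)"
      unfolding S [of p0 "\<mu> r"] S [of R "\<mu> r"] by (simp add: algebra_simps)
    have "?E r = (\<i> * (poly p0 (\<mu> r) * poly R d - poly p0 d * poly R (\<mu> r)) + t * (poly p0 d * poly T (\<mu> r)))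
        / (t * (poly R d * D r))"
      unfolding num [symmetric] t_def [symmetric] using t by (simp add: field_simps)
    also have "\<i> * (poly p0 (\<mu> r) * poly R d - poly p0 d * poly R (\<mu> r)) + t * (poly p0 d * poly T (\<mu> r))
        = \<i> * (poly p0 (\<mu> r) * poly R d - poly p0 d * D r)"
      by (simp add: D_def t_def algebra_simps)
    also have "\<i> * (poly p0 (\<mu> r) * poly R d - poly p0 d * D r) / (t * (poly R d * D r)) =
        (\<i> * (t\<^sup>2 * poly p0 (\<mu> r) / D r) - \<i> * t\<^sup>2 * (poly p0 d / poly R d)) / t ^ 3"
      using t R elim(2) by (simp add: field_simps power2_eq_square power3_eq_cube)
    finally show ?case
      using elim(1) by (simp only: t_def)
  qed
  ultimately show ?thesis
    by (auto dest: Lim_transform_eventually simp: power2_eq_square)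
qed

text \<open>
  With \<open>A = \<i> (a - d) / r\<close> and \<open>B = \<i> (b - d) / r\<close>, evaluating the factorization at \<open>d\<close> gives
  \<open>A B K(d) = p\<^sub>0(d)\<close>, and evaluating its derivative at \<open>d\<close> gives \<open>(A + B) K(d) = T(d) + O(r)\<close>. So sum and
  product of \<open>A\<close> and \<open>B\<close> converge to those of \<open>\<kappa>\<^sub>+\<close> and \<open>\<kappa>\<^sub>-\<close>.
\<close>

lemma double_root_splitting:
  fixes a b :: "real \<Rightarrow> complex" and K :: "real \<Rightarrow> complex poly" and k T p0 :: "complex poly"
  assumes lim: "(a \<longlongrightarrow> d) (at_right 0)" "(b \<longlongrightarrow> d) (at_right 0)"
    and K: "coeffs_tendsto K k (at_right 0)" and k: "poly k d \<noteq> 0"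
    and fact: "\<forall>\<^sub>F r in at_right 0.
      k * [:- d, 1:]\<^sup>2 + smult (\<i> * of_real r) ([:- d, 1:] * T) + smult (- (of_real r)\<^sup>2) p0
      = K r * ([:- a r, 1:] * [:- b r, 1:])"
    and \<kappa>: "\<kappa>p + \<kappa>m = poly T d / poly k d" "\<kappa>p * \<kappa>m = poly p0 d / poly k d"
  obtains sw where
    "((\<lambda>r. \<i> * ((if sw r then b r else a r) - d) / of_real r) \<longlongrightarrow> \<kappa>p) (at_right 0)"
    "((\<lambda>r. \<i> * ((if sw r then a r else b r) - d) / of_real r) \<longlongrightarrow> \<kappa>m) (at_right 0)"
proof -
  define A B where "A r = \<i> * (a r - d) / of_real r" and "B r = \<i> * (b r - d) / of_real r" for r :: real
  have Kd: "((\<lambda>r. poly (K r) d) \<longlongrightarrow> poly k d) (at_right 0)"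
    by (intro coeffs_tendsto_poly [OF K] tendsto_const)
  have Kd0: "\<forall>\<^sub>F r in at_right 0. poly (K r) d \<noteq> 0"
    using Kd k by (rule tendsto_imp_eventually_ne)
  have "\<forall>\<^sub>F r in at_right 0. poly p0 d / poly (K r) d = A r * B r"
    using fact Kd0 eventually_at_right_less
  proof eventually_elim
    case (elim r)
    from arg_cong [OF elim(1), of "\<lambda>q. poly q d"]
    have "- (of_real r)\<^sup>2 * poly p0 d = poly (K r) d * ((d - a r) * (d - b r))"
      by (simp add: algebra_simps)
    also have "(d - a r) * (d - b r) = - (of_real r)\<^sup>2 * (A r * B r)"
      using elim(3) by (simp add: A_def B_def field_simps power2_eq_square)
    finally show ?case
      using elim(2,3) by (simp add: field_simps)
  qed
  moreover have "((\<lambda>r. poly p0 d / poly (K r) d) \<longlongrightarrow> poly p0 d / poly k d) (at_right 0)"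
    by (intro tendsto_intros Kd k)
  ultimately have prod: "((\<lambda>r. A r * B r) \<longlongrightarrow> \<kappa>p * \<kappa>m) (at_right 0)"
    unfolding \<kappa> by (blast intro: Lim_transform_eventually)
  let ?s = "\<lambda>r. (poly T d + \<i> * of_real r * (poly (pderiv p0) d - poly (pderiv (K r)) d * (A r * B r))) / poly (K r) d"
  have "\<forall>\<^sub>F r in at_right 0. ?s r = A r + B r"
    using fact Kd0 eventually_at_right_less
  proof eventually_elim
    case (elim r)
    define t where "t = complex_of_real r"
    have t: "t \<noteq> 0" using elim by (simp add: t_def)
    have ab: "d - a r = \<i> * t * A r" "d - b r = \<i> * t * B r"
      using t by (simp_all add: A_def B_def t_def [symmetric] field_simps)
    from arg_cong [OF elim(1), of "\<lambda>q. poly (pderiv q) d"]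
    have "\<i> * t * poly T d - t\<^sup>2 * poly (pderiv p0) d =
        poly (K r) d * ((d - a r) + (d - b r)) + poly (pderiv (K r)) d * ((d - a r) * (d - b r))"
      unfolding t_def
      by (simp add: pderiv_add pderiv_diff pderiv_minus pderiv_smult pderiv_mult pderiv_pCons power2_eq_square algebra_simps
          del: mult_pCons_left mult_pCons_right)
    then have "\<i> * t * (poly T d + \<i> * t * (poly (pderiv p0) d - poly (pderiv (K r)) d * (A r * B r))) =
        \<i> * t * (poly (K r) d * (A r + B r))"
      unfolding ab by (simp add: algebra_simps power2_eq_square)
    then have "poly T d + \<i> * t * (poly (pderiv p0) d - poly (pderiv (K r)) d * (A r * B r)) =
        poly (K r) d * (A r + B r)"
      using t by simp
    with elim(2) show ?case
      by (simp add: t_def)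
  qed
  moreover have "(?s \<longlongrightarrow> (poly T d + \<i> * 0 * (poly (pderiv p0) d - poly (pderiv k) d * (\<kappa>p * \<kappa>m))) / poly k d)
      (at_right 0)"
    by (intro tendsto_intros coeffs_tendsto_poly [OF coeffs_tendsto_pderiv [OF K]] Kd k prod
        tendsto_of_real_at_right_0)
  ultimately have sum: "((\<lambda>r. A r + B r) \<longlongrightarrow> \<kappa>p + \<kappa>m) (at_right 0)"
    unfolding \<kappa> by (auto dest: Lim_transform_eventually)
  obtain sw where sw: "((\<lambda>r. if sw r then B r else A r) \<longlongrightarrow> \<kappa>p) (at_right 0)"
    "((\<lambda>r. if sw r then A r else B r) \<longlongrightarrow> \<kappa>m) (at_right 0)"
    by (rule pair_tendsto_of_sum_prod [OF sum prod])
  show ?thesis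
    by (rule that [of sw]; rule Lim_transform_eventually [OF sw(1)] Lim_transform_eventually [OF sw(2)])
       (auto simp: A_def B_def)
qed

lemma proots_quadratic:
  fixes A B C :: complex
  assumes "A \<noteq> 0"
  obtains z1 z2 where "proots [:C, - B, A:] = {#z1, z2#}" "z1 + z2 = B / A" "z1 * z2 = C / A"
proof -
  obtain zs where zs: "proots [:C, - B, A:] = mset zs"
    by (metis ex_mset)
  then have "length zs = 2"
    using assms size_proots_complex [of "[:C, - B, A:]"] by simp
  then obtain z1 z2 where "zs = [z1, z2]"
    by (auto simp: numeral_2_eq_2 length_Suc_conv)
  with zs have z: "proots [:C, - B, A:] = {#z1, z2#}"
    by simp
  have "smult A ([:- z1, 1:] * [:- z2, 1:]) = [:C, - B, A:]"
    using complex_poly_decompose_multiset [of "[:C, - B, A:]"] assms by (simp add: z)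
  then have "A * (z1 * z2) = C" "A * (z1 + z2) = B"
    by (auto simp: algebra_simps neg_eq_iff_add_eq_0 add_eq_0_iff)
  with z assms show ?thesis
    by (intro that [of z1 z2]) (auto simp: field_simps)
qed
section \<open>The labelling along a ray\<close>

text \<open>
  Equivalent to \<open>\<i> r \<mu>(r) = \<i> r d + r\<^sup>2 q + o(r\<^sup>2)\<close>, the form in which the small roots \<open>\<lambda> = \<i> r \<mu>\<close> are expanded.
\<close>

definition first_order_expansion where
  "first_order_expansion (\<mu> :: real \<Rightarrow> complex) d q \<longleftrightarrow>
    ((\<lambda>r. \<i> * (\<mu> r - of_real d) / of_real r) \<longlongrightarrow> q) (at_right 0)"

text \<open>
  The polynomial in \<open>\<mu>\<close> left over from \<open>Q\<^sub>2(\<i> r \<mu>, \<i> r \<xi>')\<close> after division by \<open>(\<i> r)\<^sup>m\<^sup>-\<^sup>2\<close>.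
\<close>

definition ray_poly :: "real poly \<Rightarrow> real poly \<Rightarrow> real poly \<Rightarrow> real \<Rightarrow> complex poly"
  where "ray_poly p0 p1 p2 r =
    cpoly p2 + smult (\<i> * of_real r) (cpoly p1) + smult (- (of_real r)\<^sup>2) (cpoly p0)"

lemma coeffs_tendsto_ray_poly: "coeffs_tendsto (ray_poly p0 p1 p2) (cpoly p2) (at_right 0)"
proof -
  have "coeffs_tendsto (ray_poly p0 p1 p2)
      (cpoly p2 + smult (\<i> * 0) (cpoly p1) + smult (- 0\<^sup>2) (cpoly p0)) (at_right 0)"
    unfolding ray_poly_def [abs_def]
    by (intro coeffs_tendsto_add coeffs_tendsto_smult coeffs_tendsto_const tendsto_intros
        tendsto_of_real_at_right_0)
  then show ?thesis by simp
qed

lemma poly_ray_poly: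
  "poly (ray_poly p0 p1 p2 r) z =
    poly (cpoly p2) z + \<i> * of_real r * poly (cpoly p1) z - (of_real r)\<^sup>2 * poly (cpoly p0) z"
  by (simp add: ray_poly_def)

context
  fixes p2 p1 :: "real poly"
  assumes inter: "interlace p2 p1" and dist: "distinct (real_roots p1)"
begin

lemma interlace_real_rooted: "real_rooted p2" "real_rooted p1"
  using inter by (auto simp: interlace_def)

lemma interlace_bounds:
  assumes "1 \<le> j" "j \<le> degree p2"
  shows "nth_root p1 j \<le> nth_root p2 j" "nth_root p2 j \<le> nth_root p1 (Suc j)"
  using inter assms by (auto simp: interlace_def)

lemma degree_p1: "degree p1 = Suc (degree p2)"
  using inter by (simp add: interlace_def)

text \<open>
  A triple root of \<open>p\<^sub>2\<close> would trap two consecutive roots of \<open>p\<^sub>1\<close>, making them equal.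
\<close>

lemma no_triple_root:
  assumes "i < j" "j < k" "1 \<le> i" "k \<le> degree p2"
    "nth_root p2 i = nth_root p2 j" "nth_root p2 j = nth_root p2 k"
  shows False
proof -
  note mono = nth_root_mono [OF interlace_real_rooted(1)]
  have "nth_root p2 (Suc i) = nth_root p2 i" "nth_root p2 (Suc (Suc i)) = nth_root p2 i"
    using assms mono [of i "Suc i"] mono [of "Suc i" j] mono [of "Suc i" "Suc (Suc i)"]
      mono [of "Suc (Suc i)" k] by auto
  moreover have "nth_root p2 i \<le> nth_root p1 (Suc i)" "nth_root p1 (Suc (Suc i)) \<le> nth_root p2 (Suc (Suc i))"
    using interlace_bounds [of i] interlace_bounds [of "Suc (Suc i)"] assms by auto
  moreover have "nth_root p1 (Suc i) < nth_root p1 (Suc (Suc i))"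
    using assms degree_p1 by (intro nth_root_strict_mono [OF interlace_real_rooted(2) dist]) auto
  ultimately show False by simp
qed

lemma double_root_between:
  assumes "1 \<le> j" "j < degree p2" "nth_root p2 j = nth_root p2 (Suc j)"
  shows "nth_root p1 (Suc j) = nth_root p2 j"
proof -
  have "nth_root p2 j \<le> nth_root p1 (Suc j)" "nth_root p1 (Suc j) \<le> nth_root p2 (Suc j)"
    using interlace_bounds [of j] interlace_bounds [of "Suc j"] assms by auto
  with assms show ?thesis by simp
qed

text \<open>
  Since \<open>b\<^sub>j \<le> d\<^sub>j \<le> b\<^sub>j\<^sub>+\<^sub>1\<close> and \<open>b\<close> is strictly increasing, a common root \<open>d\<^sub>j\<close> is one of the two end points.
\<close>

lemma common_root_factor:
  assumes j: "j \<in> {1..degree p2}" and root: "poly p1 (nth_root p2 j) = 0"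
  shows "p1 = [:- nth_root p2 j, 1:] *
    (if nth_root p2 j = nth_root p1 j then omit_root p1 j else omit_root p1 (j + 1))"
proof -
  have between: "nth_root p1 j \<le> nth_root p2 j" "nth_root p2 j \<le> nth_root p1 (j + 1)"
    using interlace_bounds [of j] j by auto
  obtain i where i: "i \<in> {1..degree p1}" "nth_root p2 j = nth_root p1 i"
    by (rule root_is_nth_root [OF interlace_real_rooted(2) root])
  note strict = nth_root_strict_mono [OF interlace_real_rooted(2) dist]
  have "i = j \<or> i = j + 1"
    using strict [of i j] strict [of "j + 1" i] between i j degree_p1 by force
  then have "nth_root p2 j = nth_root p1 (j + 1)" if "nth_root p2 j \<noteq> nth_root p1 j"
    using i that by auto
  with omit_root_correct [OF interlace_real_rooted(2), of j]
    omit_root_correct [OF interlace_real_rooted(2), of "j + 1"] j degree_p1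
  show ?thesis by auto
qed

text \<open>
  The two converging roots split off at a double root are grouped against all the remaining
  factors, whose product converges to the quotient of \<open>p\<^sub>2\<close> by \<open>(\<lambda> - d\<^sub>j)\<^sup>2\<close>. Its value at \<open>d\<^sub>j\<close> is
  nonzero because there is no triple root.
\<close>

lemma double_root_pair:
  assumes j: "1 \<le> j" "j < degree p2" and dbl: "nth_root p2 j = nth_root p2 (Suc j)"
    and lim: "\<And>i. i \<in> {1..degree p2} \<Longrightarrow> (\<rho> i \<longlongrightarrow> of_real (nth_root p2 i)) (at_right 0)"
    and h: "coeffs_tendsto h [:of_real (lead_coeff p2):] (at_right 0)"
    and fact: "\<forall>\<^sub>F r in at_right 0.
      ray_poly p0 p1 p2 r = h r * (\<Prod>i\<in>{1..degree p2}. [:- \<rho> i r, 1:])"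
  shows "\<exists>sw \<kappa>p \<kappa>m.
    proots [:of_real (poly p0 (nth_root p2 j)), - of_real (poly (omit_root p1 (j + 1)) (nth_root p2 j)),
      of_real (poly (omit_root2 p2 j) (nth_root p2 j)):] = {#\<kappa>p, \<kappa>m#} \<and>
    ((\<lambda>r. \<i> * ((if sw r then \<rho> (Suc j) r else \<rho> j r) - of_real (nth_root p2 j)) / of_real r) \<longlongrightarrow> \<kappa>p) (at_right 0) \<and>
    ((\<lambda>r. \<i> * ((if sw r then \<rho> j r else \<rho> (Suc j) r) - of_real (nth_root p2 j)) / of_real r) \<longlongrightarrow> \<kappa>m) (at_right 0)"
proof -
  let ?M = "{1..degree p2}" and ?d = "nth_root p2 j"
  let ?l = "\<lambda>i r. [:- \<rho> i r, 1:]"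
  define K where "K r = h r * (\<Prod>i\<in>?M - {j, Suc j}. ?l i r)" for r
  define k where "k = cpoly (omit_root2 p2 j)"
  have k_eq: "k = [:of_real (lead_coeff p2):] * (\<Prod>i\<in>?M - {j, Suc j}. [:- of_real (nth_root p2 i), 1:])"
    unfolding k_def by (subst omit_root2_eq [OF interlace_real_rooted(1)])
      (use j in \<open>auto simp: cpoly_smult cpoly_prod\<close>)
  have K: "coeffs_tendsto K k (at_right 0)"
    unfolding K_def [abs_def] k_eq
    by (intro coeffs_tendsto_mult coeffs_tendsto_prod coeffs_tendsto_linear lim h) auto
  have split: "(\<Prod>i\<in>?M. f i) = (\<Prod>i\<in>?M - {j, Suc j}. f i) * (f j * f (Suc j))" for f :: "nat \<Rightarrow> complex poly"
    using j by (subst prod.subset_diff [of "{j, Suc j}"]) auto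
  have const_mult: "smult c q = [:c:] * q" for c :: complex and q
    by simp
  have p2: "cpoly p2 = k * [:- of_real ?d, 1:]\<^sup>2"
    unfolding cpoly_real_roots [OF interlace_real_rooted(1)] split k_eq dbl [symmetric]
    unfolding const_mult power2_eq_square by (simp only: mult_ac)
  have "poly k (of_real ?d) \<noteq> 0"
  proof
    assume "poly k (of_real ?d) = 0"
    then have "\<exists>i\<in>?M - {j, Suc j}. ?d = nth_root p2 i"
      using real_rooted_nonzero [OF interlace_real_rooted(1)]
      by (auto simp: k_eq poly_prod)
    then obtain i where "i \<in> ?M - {j, Suc j}" "?d = nth_root p2 i"
      by blast
    then show False
      using no_triple_root [of i j "Suc j"] no_triple_root [of j "Suc j" i] j dbl by force
  qed
  then have A: "complex_of_real (poly (omit_root2 p2 j) ?d) \<noteq> 0"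
    by (simp add: k_def)
  define T where "T = cpoly (omit_root p1 (j + 1))"
  have "p1 = [:- ?d, 1:] * omit_root p1 (j + 1)"
    using omit_root_correct [OF interlace_real_rooted(2), of "j + 1"] double_root_between [OF j dbl] j degree_p1
    by auto
  then have p1: "cpoly p1 = [:- of_real ?d, 1:] * T"
    unfolding T_def by (metis cpoly_linear cpoly_mult)
  obtain \<kappa>p \<kappa>m where \<kappa>: "proots [:complex_of_real (poly p0 ?d), - of_real (poly (omit_root p1 (j + 1)) ?d),
      of_real (poly (omit_root2 p2 j) ?d):] = {#\<kappa>p, \<kappa>m#}"
    "\<kappa>p + \<kappa>m = of_real (poly (omit_root p1 (j + 1)) ?d) / of_real (poly (omit_root2 p2 j) ?d)"
    "\<kappa>p * \<kappa>m = of_real (poly p0 ?d) / of_real (poly (omit_root2 p2 j) ?d)"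
    by (rule proots_quadratic [OF A])
  have fact': "\<forall>\<^sub>F r in at_right 0.
      k * [:- of_real ?d, 1:]\<^sup>2 + smult (\<i> * of_real r) ([:- of_real ?d, 1:] * T)
        + smult (- (of_real r)\<^sup>2) (cpoly p0) = K r * (?l j r * ?l (Suc j) r)"
    using fact
  proof eventually_elim
    case (elim r)
    then show ?case
      unfolding ray_poly_def p2 [symmetric] p1 [symmetric] K_def split by (simp only: mult.assoc)
  qed
  have lims: "(\<rho> j \<longlongrightarrow> of_real ?d) (at_right 0)" "(\<rho> (Suc j) \<longlongrightarrow> of_real ?d) (at_right 0)"
    using lim [of j] lim [of "Suc j"] j dbl by auto
  obtain sw where
    "((\<lambda>r. \<i> * ((if sw r then \<rho> (Suc j) r else \<rho> j r) - of_real ?d) / of_real r) \<longlongrightarrow> \<kappa>p) (at_right 0)"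
    "((\<lambda>r. \<i> * ((if sw r then \<rho> j r else \<rho> (Suc j) r) - of_real ?d) / of_real r) \<longlongrightarrow> \<kappa>m) (at_right 0)"
    by (rule double_root_splitting [OF lims K _ fact', of \<kappa>p \<kappa>m]) (use \<kappa> A in \<open>simp_all add: k_def T_def\<close>)
  with \<kappa>(1) show ?thesis by blast
qed

lemma simple_root_expansions:
  assumes j: "j \<in> {1..degree p2}" and simple: "poly (omit_root p2 j) (nth_root p2 j) \<noteq> 0"
    and lim: "(\<mu> \<longlongrightarrow> of_real (nth_root p2 j)) (at_right 0)"
    and root: "\<forall>\<^sub>F r in at_right 0. poly (ray_poly p0 p1 p2 r) (\<mu> r) = 0"
  shows "((\<lambda>r. \<i> * (\<mu> r - of_real (nth_root p2 j)) / of_real r) \<longlongrightarrow>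
      of_real (poly p1 (nth_root p2 j) / poly (omit_root p2 j) (nth_root p2 j))) (at_right 0)"
    and "poly p1 (nth_root p2 j) = 0 \<Longrightarrow>
      ((\<lambda>r. (\<i> * (\<mu> r - of_real (nth_root p2 j)) - \<i> * (of_real r)\<^sup>2 *
          of_real (poly p0 (nth_root p2 j) / poly (omit_root p2 j) (nth_root p2 j))) / of_real r ^ 3) \<longlongrightarrow>
        of_real (poly p0 (nth_root p2 j) *
          poly (if nth_root p2 j = nth_root p1 j then omit_root p1 j else omit_root p1 (j + 1)) (nth_root p2 j)
          / (poly (omit_root p2 j) (nth_root p2 j))\<^sup>2)) (at_right 0)"
proof -
  let ?d = "nth_root p2 j"
  define R where "R = cpoly (omit_root p2 j)"
  have R: "poly R (of_real ?d) \<noteq> 0"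
    using simple by (simp add: R_def)
  have p2: "cpoly p2 = [:- of_real ?d, 1:] * R"
    unfolding R_def using omit_root_correct [OF interlace_real_rooted(1) j] by (metis cpoly_linear cpoly_mult)
  have p2v: "poly (cpoly p2) z = (z - of_real ?d) * poly R z" for z
    unfolding p2 by (simp add: algebra_simps)
  show "((\<lambda>r. \<i> * (\<mu> r - of_real ?d) / of_real r) \<longlongrightarrow>
      of_real (poly p1 ?d / poly (omit_root p2 j) ?d)) (at_right 0)"
    using simple_root_first_order [OF lim R, of "cpoly p1" "cpoly p0"] root
    by (simp add: poly_ray_poly p2v R_def)
  assume "poly p1 ?d = 0"
  note p1 = common_root_factor [OF j this]
  define T where "T = cpoly (if ?d = nth_root p1 j then omit_root p1 j else omit_root p1 (j + 1))"
  have p1': "cpoly p1 = [:- of_real ?d, 1:] * T"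
    unfolding T_def using p1 by (metis cpoly_linear cpoly_mult)
  have p1v: "poly (cpoly p1) z = (z - of_real ?d) * poly T z" for z
    unfolding p1' by (simp add: algebra_simps)
  show "((\<lambda>r. (\<i> * (\<mu> r - of_real ?d) - \<i> * (of_real r)\<^sup>2 *
          of_real (poly p0 ?d / poly (omit_root p2 j) ?d)) / of_real r ^ 3) \<longlongrightarrow>
        of_real (poly p0 ?d *
          poly (if ?d = nth_root p1 j then omit_root p1 j else omit_root p1 (j + 1)) ?d
          / (poly (omit_root p2 j) ?d)\<^sup>2)) (at_right 0)"
    using simple_root_common [OF lim R, of T "cpoly p0"] root
    by (simp add: poly_ray_poly p2v p1v R_def T_def)
qed

end

text \<open>
  What the theorem says about the \<open>m - 2\<close> small roots \<open>\<lambda>\<^sub>j = \<i> r \<mu>\<^sub>j\<close> on one ray, in terms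
  of the \<open>\<mu>\<^sub>j\<close>. The last clause is phrased with \<open>d\<^sub>j = d\<^sub>j\<^sub>+\<^sub>1\<close> alone because interlacing places
  \<open>b\<^sub>j\<^sub>+\<^sub>1\<close> between the two.
\<close>

definition ray_expansion ::
    "real poly \<Rightarrow> real poly \<Rightarrow> real poly \<Rightarrow> (nat \<Rightarrow> real \<Rightarrow> complex) \<Rightarrow> bool"
  where "ray_expansion p0 p1 p2 \<mu> \<longleftrightarrow> (let d = nth_root p2; b = nth_root p1 in
    (\<forall>j\<in>{1..degree p2}. (\<mu> j \<longlongrightarrow> of_real (d j)) (at_right 0)) \<and>
    (\<forall>\<^sub>F r in at_right 0.
      image_mset (\<lambda>j. \<mu> j r) (mset_set {1..degree p2}) \<subseteq># proots (ray_poly p0 p1 p2 r)) \<and>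
    (\<forall>j\<in>{1..degree p2}. poly (omit_root p2 j) (d j) \<noteq> 0 \<longrightarrow>
      first_order_expansion (\<mu> j) (d j) (of_real (poly p1 (d j) / poly (omit_root p2 j) (d j))) \<and>
      (poly p1 (d j) = 0 \<longrightarrow>
        ((\<lambda>r. (\<i> * (\<mu> j r - of_real (d j)) - \<i> * (of_real r)\<^sup>2 *
            of_real (poly p0 (d j) / poly (omit_root p2 j) (d j))) / of_real r ^ 3) \<longlongrightarrow>
          of_real (poly p0 (d j) * poly (if d j = b j then omit_root p1 j else omit_root p1 (j + 1)) (d j)
            / (poly (omit_root p2 j) (d j))\<^sup>2)) (at_right 0))) \<and>
    (\<forall>j\<in>{1..<degree p2}. d j = d (j + 1) \<longrightarrow> (\<exists>\<kappa>p \<kappa>m.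
      proots [:of_real (poly p0 (d j)), - of_real (poly (omit_root p1 (j + 1)) (d j)),
        of_real (poly (omit_root2 p2 j) (d j)):] = {#\<kappa>p, \<kappa>m#} \<and>
      first_order_expansion (\<mu> j) (d j) \<kappa>p \<and> first_order_expansion (\<mu> (j + 1)) (d j) \<kappa>m)))"

text \<open>
  Splitting off all the roots \<open>d\<^sub>j\<close> of the limit \<open>p\<^sub>2\<close> gives roots \<open>\<rho>\<^sub>j \<longlongrightarrow> d\<^sub>j\<close>. This settles
  simple roots. At a double root \<open>d\<^sub>j = d\<^sub>j\<^sub>+\<^sub>1\<close> the two labels may still have to be swapped, depending on \<open>r\<close>.
  Different pairs \<open>(j, j + 1)\<close> are disjoint because there is no triple root, so for each \<open>r\<close> the swaps combine into an
  involution of the labels and the multiset of roots is unchanged.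
\<close>

lemma ray_labelling:
  assumes inter: "interlace p2 p1" and dist: "distinct (real_roots p1)"
  shows "\<exists>\<mu>. ray_expansion p0 p1 p2 \<mu>"
proof -
  define d b where "d = nth_root p2" and "b = nth_root p1"
  let ?M = "{1..degree p2}" and ?G = "ray_poly p0 p1 p2"
  note rr = interlace_real_rooted [OF inter dist]
  have lc: "lead_coeff p2 \<noteq> 0"
    using real_rooted_nonzero [OF rr(1)] by simp
  have "coeffs_tendsto ?G ([:of_real (lead_coeff p2):] * (\<Prod>j\<in>?M. [:- of_real (d j), 1:])) (at_right 0)"
    using coeffs_tendsto_ray_poly [of p0 p1 p2] cpoly_real_roots [OF rr(1)] by (simp add: d_def)
  moreover have "[:complex_of_real (lead_coeff p2):] \<noteq> 0"
    using lc by simp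
  ultimately obtain \<rho> h where \<rho>: "\<And>i. i \<in> ?M \<Longrightarrow> (\<rho> i \<longlongrightarrow> of_real (d i)) (at_right 0)"
    and h: "coeffs_tendsto h [:complex_of_real (lead_coeff p2):] (at_right 0)"
    and fact: "\<forall>\<^sub>F r in at_right 0. ?G r = h r * (\<Prod>i\<in>?M. [:- \<rho> i r, 1:])"
    using split_off_roots [OF finite_atLeastAtMost, of ?G _ "\<lambda>j. of_real (d j)" 1 "degree p2"] by blast
  define D where "D = {j \<in> {1..<degree p2}. d j = d (Suc j)}"
  have D_Suc: "Suc j \<notin> D" if "j \<in> D" for j
    using no_triple_root [OF inter dist, of j "Suc j" "Suc (Suc j)"] that by (auto simp: D_def d_def)
  define good where "good j sw \<longleftrightarrow> (\<exists>\<kappa>p \<kappa>m.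
      proots [:complex_of_real (poly p0 (d j)), - of_real (poly (omit_root p1 (j + 1)) (d j)),
        of_real (poly (omit_root2 p2 j) (d j)):] = {#\<kappa>p, \<kappa>m#} \<and>
      first_order_expansion (\<lambda>r. if sw r then \<rho> (Suc j) r else \<rho> j r) (d j) \<kappa>p \<and>
      first_order_expansion (\<lambda>r. if sw r then \<rho> j r else \<rho> (Suc j) r) (d j) \<kappa>m)" for j sw
  have "\<forall>j\<in>D. \<exists>sw. good j sw"
    unfolding good_def first_order_expansion_def
    using double_root_pair [OF inter dist _ _ _ _ h fact] \<rho> by (auto simp: D_def d_def)
  then obtain sw where sw: "\<And>j. j \<in> D \<Longrightarrow> good j (sw j)"
    by metis
  \<comment> \<open>The involution that performs, for this \<open>r\<close>, all the swaps that are required.\<close>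
  define \<pi> where "\<pi> r j = (if j \<in> D \<and> sw j r then Suc j
    else if 0 < j \<and> j - 1 \<in> D \<and> sw (j - 1) r then j - 1 else j)" for r j
  have \<pi>_inv: "\<pi> r (\<pi> r j) = j" for r j
    using D_Suc [of j] D_Suc [of "j - 1"] D_Suc [of "j - 2"] by (auto simp: \<pi>_def numeral_2_eq_2)
  have \<pi>_M: "\<pi> r j \<in> ?M" if "j \<in> ?M" for r j
    using that by (auto simp: \<pi>_def D_def)
  have bij: "bij_betw (\<pi> r) ?M ?M" for r
    by (rule bij_betw_byWitness [of _ "\<pi> r"]) (use \<pi>_inv \<pi>_M in auto)
  define \<mu> where "\<mu> j r = \<rho> (\<pi> r j) r" for j r
  have \<mu>_pair: "\<mu> j = (\<lambda>r. if sw j r then \<rho> (Suc j) r else \<rho> j r)"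
      "\<mu> (Suc j) = (\<lambda>r. if sw j r then \<rho> j r else \<rho> (Suc j) r)" if "j \<in> D" for j
    using that D_Suc [of j] D_Suc [of "j - 1"] by (auto simp: \<mu>_def \<pi>_def fun_eq_iff)
  have \<mu>_other: "\<mu> j = \<rho> j" if "j \<notin> D" "0 < j \<Longrightarrow> j - 1 \<notin> D" for j
    using that by (auto simp: \<mu>_def \<pi>_def fun_eq_iff)
  have lim: "(\<mu> j \<longlongrightarrow> of_real (d j)) (at_right 0)" if j: "j \<in> ?M" for j
  proof -
    consider "j \<in> D" | "0 < j" "j - 1 \<in> D" | "j \<notin> D" "0 < j \<Longrightarrow> j - 1 \<notin> D"
      by blast
    then show ?thesis
    proof cases
      case 1
      then have "Suc j \<in> ?M" "d (Suc j) = d j" by (auto simp: D_def)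
      with \<rho> [of "Suc j"] \<rho> [of j] j show ?thesis
        unfolding \<mu>_pair [OF 1] by (auto intro: tendsto_if_same)
    next
      case 2
      then have "j - 1 \<in> ?M" "d (j - 1) = d j" by (auto simp: D_def)
      with \<rho> [of "j - 1"] \<rho> [of j] j show ?thesis
        using \<mu>_pair(2) [OF 2(2)] 2(1) by (auto intro: tendsto_if_same)
    next
      case 3
      with \<rho> [of j] j show ?thesis by (simp add: \<mu>_other)
    qed
  qed
  have fact\<mu>: "\<forall>\<^sub>F r in at_right 0. ?G r = h r * (\<Prod>j\<in>?M. [:- \<mu> j r, 1:])"
    using fact
  proof eventually_elim
    case (elim r)
    then show ?case
      unfolding \<mu>_def using prod.reindex_bij_betw [OF bij, of "\<lambda>i. [:- \<rho> i r, 1:]" r] by simp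
  qed
  have "((\<lambda>r. coeff (h r) 0) \<longlongrightarrow> complex_of_real (lead_coeff p2)) (at_right 0)"
    using coeffs_tendsto_coeff [OF h, of 0] by simp
  then have "\<forall>\<^sub>F r in at_right 0. coeff (h r) 0 \<noteq> 0"
    by (rule tendsto_imp_eventually_ne) (use lc in simp)
  then have subset: "\<forall>\<^sub>F r in at_right 0. image_mset (\<lambda>j. \<mu> j r) (mset_set ?M) \<subseteq># proots (?G r)"
    using fact\<mu>
  proof eventually_elim
    case (elim r)
    have "(\<Prod>j\<in>?M. [:- \<mu> j r, 1:]) \<noteq> 0"
      by simp
    moreover have "proots (\<Prod>j\<in>?M. [:- \<mu> j r, 1:]) = image_mset (\<lambda>j. \<mu> j r) (mset_set ?M)"
      by (subst proots_prod) (auto simp: sum_unfold_sum_mset)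
    moreover have "h r \<noteq> 0"
      using elim by auto
    ultimately show ?case
      unfolding elim(2) by (subst proots_mult) auto
  qed
  have root: "\<forall>\<^sub>F r in at_right 0. poly (?G r) (\<mu> j r) = 0" if "j \<in> ?M" for j
    using fact\<mu> by eventually_elim (use that in \<open>auto simp: poly_prod\<close>)
  have pairs: "\<exists>\<kappa>p \<kappa>m.
      proots [:complex_of_real (poly p0 (d j)), - of_real (poly (omit_root p1 (j + 1)) (d j)),
        of_real (poly (omit_root2 p2 j) (d j)):] = {#\<kappa>p, \<kappa>m#} \<and>
      first_order_expansion (\<mu> j) (d j) \<kappa>p \<and> first_order_expansion (\<mu> (Suc j)) (d j) \<kappa>m"
    if "j \<in> {1..<degree p2}" "d j = d (Suc j)" for j
  proof -
    have "j \<in> D" using that by (simp add: D_def)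
    from sw [OF this] show ?thesis
      unfolding good_def \<mu>_pair [OF \<open>j \<in> D\<close>] .
  qed
  show ?thesis
    using lim subset pairs simple_root_expansions [OF inter dist, folded d_def b_def, OF _ _ lim root]
    unfolding ray_expansion_def Let_def d_def [symmetric] b_def [symmetric] first_order_expansion_def
    by (intro exI [of _ \<mu>] conjI ballI impI) simp_all
qed

section \<open>From rays to a neighbourhood of the origin\<close>

lemma tendsto_nhds_value:
  fixes f :: "'a::topological_space \<Rightarrow> 'b::t1_space"
  assumes "(f \<longlongrightarrow> l) (nhds a)"
  shows "f a = l"
proof (rule ccontr)
  assume "f a \<noteq> l"
  then have "\<forall>\<^sub>F x in nhds a. f x \<in> - {f a}"
    using assms by (intro topological_tendstoD) auto
  then show False
    using eventually_nhds_x_imp_x by fastforce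
qed

lemma smallo_power_at_right_0:
  assumes "((\<lambda>r. f r / complex_of_real r ^ k) \<longlongrightarrow> 0) (at_right 0)"
  shows "f \<in> o[at_right 0](\<lambda>r. complex_of_real r ^ k)"
  using assms
proof (rule smalloI_tendsto)
  show "\<forall>\<^sub>F r in at_right (0::real). complex_of_real r ^ k \<noteq> 0"
    using eventually_at_right_less by eventually_elim simp
qed

lemma first_order_smallo:
  assumes exp: "first_order_expansion \<mu> d q"
    and l: "\<forall>\<^sub>F r in at_right 0. l r = \<i> * of_real r * \<mu> r"
  shows "(\<lambda>r. l r - (\<i> * of_real (r * d) + of_real (r ^ 2) * q)) \<in> o[at_right 0](\<lambda>r. complex_of_real r ^ 2)"
proof (rule smallo_power_at_right_0)
  have "((\<lambda>r. \<i> * (\<mu> r - of_real d) / of_real r - q) \<longlongrightarrow> 0) (at_right 0)"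
    using exp by (simp add: first_order_expansion_def LIM_zero)
  moreover have "\<forall>\<^sub>F r in at_right 0. \<i> * (\<mu> r - of_real d) / of_real r - q =
      (l r - (\<i> * of_real (r * d) + of_real (r ^ 2) * q)) / of_real r ^ 2"
    using l eventually_at_right_less
    by eventually_elim (simp add: field_simps power2_eq_square)
  ultimately show "((\<lambda>r. (l r - (\<i> * of_real (r * d) + of_real (r ^ 2) * q)) / of_real r ^ 2) \<longlongrightarrow> 0) (at_right 0)"
    by (rule Lim_transform_eventually)
qed

lemma third_order_smallo:
  assumes exp: "((\<lambda>r. (\<i> * (\<mu> r - of_real d) - \<i> * (of_real r)\<^sup>2 * of_real e) / of_real r ^ 3) \<longlongrightarrow> of_real q) (at_right 0)"
    and l: "\<forall>\<^sub>F r in at_right 0. l r = \<i> * of_real r * \<mu> r"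
  shows "(\<lambda>r. l r - (\<i> * of_real (r * d) + \<i> * of_real (r ^ 3 * e) + of_real (r ^ 4 * q)))
    \<in> o[at_right 0](\<lambda>r. complex_of_real r ^ 4)"
proof (rule smallo_power_at_right_0)
  have "((\<lambda>r. (\<i> * (\<mu> r - of_real d) - \<i> * (of_real r)\<^sup>2 * of_real e) / of_real r ^ 3 - of_real q) \<longlongrightarrow> 0) (at_right 0)"
    using exp by (simp add: LIM_zero)
  moreover have "\<forall>\<^sub>F r in at_right 0.
      (\<i> * (\<mu> r - of_real d) - \<i> * (of_real r)\<^sup>2 * of_real e) / of_real r ^ 3 - of_real q =
      (l r - (\<i> * of_real (r * d) + \<i> * of_real (r ^ 3 * e) + of_real (r ^ 4 * q))) / of_real r ^ 4"
    using l eventually_at_right_less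
    by eventually_elim (simp add: field_simps power2_eq_square power3_eq_cube power4_eq_xxxx)
  ultimately show "((\<lambda>r. (l r - (\<i> * of_real (r * d) + \<i> * of_real (r ^ 3 * e) + of_real (r ^ 4 * q)))
      / of_real r ^ 4) \<longlongrightarrow> 0) (at_right 0)"
    by (rule Lim_transform_eventually)
qed

text \<open>
  Both branches for the roots of \<open>\<lambda>\<^sup>2 + c\<^sub>1 \<lambda> + c\<^sub>2\<close> are \<open>(- c\<^sub>1 \<plusminus> w) / 2\<close> for a complex square root
  \<open>w\<close> of the discriminant.
\<close>

lemma characteristic_roots_at_0:
  fixes c1 c2 :: real
  defines "D \<equiv> c1\<^sup>2 - 4 * c2"
  defines "zp \<equiv> if D \<ge> 0 then complex_of_real ((- c1 + sqrt D) / 2)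
      else (- complex_of_real c1 + \<i> * complex_of_real (sqrt (- D))) / 2"
    and "zm \<equiv> if D \<ge> 0 then complex_of_real ((- c1 - sqrt D) / 2)
      else (- complex_of_real c1 - \<i> * complex_of_real (sqrt (- D))) / 2"
  shows "zp + zm = - of_real c1" "zp * zm = of_real c2"
proof -
  show "zp + zm = - of_real c1"
    by (simp add: zp_def zm_def field_simps)
  define w where "w = (if D \<ge> 0 then complex_of_real (sqrt D) else \<i> * complex_of_real (sqrt (- D)))"
  have "w\<^sup>2 = of_real D"
    by (auto simp: w_def power_mult_distrib simp flip: of_real_power)
  moreover have "zp = (- of_real c1 + w) / 2" "zm = (- of_real c1 - w) / 2"
    by (auto simp: zp_def zm_def w_def)
  from this have "zp * zm = ((of_real c1)\<^sup>2 - w\<^sup>2) / 4"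
    by (simp only:) (simp add: field_simps power2_eq_square)
  ultimately show "zp * zm = of_real c2"
    by (simp add: D_def)
qed

theorem lemma5p1:
  fixes m :: nat and Pm Pm1 Pm2 :: "'n::finite coeffs"
  assumes m: "m \<ge> 3"
    and lead: "Pm m (\<lambda>_. 0) = 1" "Pm1 (m - 1) (\<lambda>_. 0) > 0" "Pm2 (m - 2) (\<lambda>_. 0) > 0"
    and hyp: "hyperbolic (m - 2) Pm2" "hyperbolic m Pm"
    and strict: "strictly_hyperbolic (m - 1) Pm1"
    and inter21: "\<And>\<xi>' :: real ^ 'n. norm \<xi>' = 1 \<Longrightarrow> interlace (symbol (m - 2) Pm2 \<xi>') (symbol (m - 1) Pm1 \<xi>')"
    and inter10: "\<And>\<xi>' :: real ^ 'n. norm \<xi>' = 1 \<Longrightarrow> interlace (symbol (m - 1) Pm1 \<xi>') (symbol m Pm \<xi>')"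
    and nocommon: "\<not> (\<exists>(l :: real) (\<xi>' :: real ^ 'n). norm \<xi>' = 1 \<and>
          poly (symbol (m - 2) Pm2 \<xi>') l = 0 \<and> poly (symbol (m - 1) Pm1 \<xi>') l = 0 \<and>
          poly (symbol m Pm \<xi>') l = 0)"
  shows "\<exists>lam :: nat \<Rightarrow> real ^ 'n \<Rightarrow> complex.
    (\<forall>\<xi>. proots (symbol m Pm (times_ii \<xi>) + symbol (m - 1) Pm1 (times_ii \<xi>)
                  + symbol (m - 2) Pm2 (times_ii \<xi>))
          = image_mset (\<lambda>j. lam j \<xi>) (mset_set {1..m})) \<and>
    (\<forall>j\<in>{1..m}. isCont (lam j) 0) \<and>
    (let c1 = Pm1 (m - 1) (\<lambda>_. 0); c2 = Pm2 (m - 2) (\<lambda>_. 0) in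
      (c1\<^sup>2 \<ge> 4 * c2 \<longrightarrow>
         lam (m - 1) 0 = complex_of_real ((- c1 + sqrt (c1\<^sup>2 - 4 * c2)) / 2) \<and>
         lam m 0 = complex_of_real ((- c1 - sqrt (c1\<^sup>2 - 4 * c2)) / 2)) \<and>
      (c1\<^sup>2 < 4 * c2 \<longrightarrow>
         lam (m - 1) 0 = (- complex_of_real c1 + \<i> * complex_of_real (sqrt (4 * c2 - c1\<^sup>2))) / 2 \<and>
         lam m 0 = (- complex_of_real c1 - \<i> * complex_of_real (sqrt (4 * c2 - c1\<^sup>2))) / 2)) \<and>
    (\<forall>\<xi>' :: real ^ 'n. norm \<xi>' = 1 \<longrightarrow>
      (let p0 = symbol m Pm \<xi>'; p1 = symbol (m - 1) Pm1 \<xi>'; p2 = symbol (m - 2) Pm2 \<xi>';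
           b = nth_root p1; d = nth_root p2
       in
        (\<forall>j\<in>{1..m - 2}.
          poly p1 (d j) \<noteq> 0 \<and> poly (omit_root p2 j) (d j) \<noteq> 0 \<longrightarrow>
            (\<lambda>r. lam j (r *\<^sub>R \<xi>') -
                 (\<i> * complex_of_real (r * d j)
                  + complex_of_real (r ^ 2 * (poly p1 (d j) / poly (omit_root p2 j) (d j)))))
            \<in> o[at_right 0](\<lambda>r. complex_of_real r ^ 2)) \<and>
        (\<forall>j\<in>{1..m - 2}.
          poly p1 (d j) = 0 \<and> poly (omit_root p2 j) (d j) \<noteq> 0 \<longrightarrow>
            (let p1t = (if d j = b j then omit_root p1 j else omit_root p1 (j + 1)) in
             (\<lambda>r. lam j (r *\<^sub>R \<xi>') -
                 (\<i> * complex_of_real (r * d j)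
                  + \<i> * complex_of_real (r ^ 3 * (poly p0 (d j) / poly (omit_root p2 j) (d j)))
                  + complex_of_real (r ^ 4 * (poly p0 (d j) * poly p1t (d j)
                                              / (poly (omit_root p2 j) (d j))\<^sup>2))))
             \<in> o[at_right 0](\<lambda>r. complex_of_real r ^ 4))) \<and>
        (\<forall>j\<in>{1..<m - 2}.
          d j = b (j + 1) \<and> b (j + 1) = d (j + 1) \<longrightarrow>
            (\<exists>\<kappa>p \<kappa>m :: complex.
              proots [:complex_of_real (poly p0 (d j)),
                       - complex_of_real (poly (omit_root p1 (j + 1)) (d j)),
                       complex_of_real (poly (omit_root2 p2 j) (d j)):] = {#\<kappa>p, \<kappa>m#} \<and>
              (\<lambda>r. lam j (r *\<^sub>R \<xi>') -
                   (\<i> * complex_of_real (r * d j) + complex_of_real (r ^ 2) * \<kappa>p))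
              \<in> o[at_right 0](\<lambda>r. complex_of_real r ^ 2) \<and>
              (\<lambda>r. lam (j + 1) (r *\<^sub>R \<xi>') -
                   (\<i> * complex_of_real (r * d j) + complex_of_real (r ^ 2) * \<kappa>m))
              \<in> o[at_right 0](\<lambda>r. complex_of_real r ^ 2)))))"
proof -
  define k where "k = m - 2"
  have m_eq: "m = Suc (Suc k)" "m - 1 = Suc k" "m - 2 = k"
    using m by (auto simp: k_def)
  define c1 c2 where "c1 = Pm1 (m - 1) (\<lambda>_. 0)" and "c2 = Pm2 (m - 2) (\<lambda>_. 0)"
  have c2: "c2 > 0" using lead by (simp add: c2_def)
  define zp where "zp = (if c1\<^sup>2 - 4 * c2 \<ge> 0 then complex_of_real ((- c1 + sqrt (c1\<^sup>2 - 4 * c2)) / 2)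
      else (- complex_of_real c1 + \<i> * complex_of_real (sqrt (- (c1\<^sup>2 - 4 * c2)))) / 2)"
  define zm where "zm = (if c1\<^sup>2 - 4 * c2 \<ge> 0 then complex_of_real ((- c1 - sqrt (c1\<^sup>2 - 4 * c2)) / 2)
      else (- complex_of_real c1 - \<i> * complex_of_real (sqrt (- (c1\<^sup>2 - 4 * c2)))) / 2)"
  have z: "zp + zm = - of_real c1" "zp * zm = of_real c2"
    unfolding zp_def zm_def by (rule characteristic_roots_at_0)+
  then have z0: "zp \<noteq> 0" "zm \<noteq> 0" using c2 by auto
  \<comment> \<open>The limits of the labelled roots: \<open>Q\<^sub>2(\<lambda>, 0) = \<lambda>\<^sup>m\<^sup>-\<^sup>2 (\<lambda>\<^sup>2 + c\<^sub>1 \<lambda> + c\<^sub>2)\<close>.\<close>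
  define l where "l j = (if j = Suc k then zp else if j = m then zm else 0)" for j
  define Q where "Q \<xi> = symbol m Pm (times_ii \<xi>) + symbol (m - 1) Pm1 (times_ii \<xi>)
      + symbol (m - 2) Pm2 (times_ii \<xi>)" for \<xi> :: "real ^ 'n"
  have range_m: "{1..m} = insert (Suc k) (insert m {1..k})" by (auto simp: m_eq)
  have Q0: "Q 0 = (\<Prod>j\<in>{1..m}. [:- l j, 1:])"
  proof -
    have "(\<Prod>j\<in>{1..k}. [:- l j, 1:]) = (\<Prod>j\<in>{1..k}. monom 1 1)"
      by (intro prod.cong) (auto simp: l_def m_eq monom_altdef)
    also have "\<dots> = monom 1 k"
      by (simp add: monom_power)
    finally have "(\<Prod>j\<in>{1..m}. [:- l j, 1:]) = ([:- zp, 1:] * [:- zm, 1:]) * monom 1 k"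
      unfolding range_m by (simp add: l_def m_eq mult.assoc del: mult_pCons_left)
    also have "[:- zp, 1:] * [:- zm, 1:] = [:of_real c2, of_real c1, 1:]"
    proof -
      have "complex_of_real c1 = - (zp + zm)" using z by simp
      then show ?thesis by (simp add: z(2) [symmetric])
    qed
    also have "\<dots> = monom 1 2 + monom (of_real c1) 1 + monom (of_real c2) 0"
      by (simp add: monom_altdef power2_eq_square)
    also have "\<dots> * monom 1 k = Q 0"
      using lead by (simp add: Q_def times_ii_0 symbol_0 distrib_right mult_monom c1_def c2_def m_eq)
    finally show ?thesis by simp
  qed
  have "coeffs_tendsto Q (Q 0) (nhds 0)"
    unfolding Q_def by (intro coeffs_tendsto_add coeffs_tendsto_symbol tendsto_times_ii filterlim_ident)
  then have convQ: "coeffs_tendsto Q (\<Prod>j\<in>{1..m}. [:- l j, 1:]) (nhds 0)"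
    by (simp add: Q0)
  have lowdeg: "degree (symbol (m - 1) Pm1 (times_ii \<xi>)) < m" "degree (symbol (m - 2) Pm2 (times_ii \<xi>)) < m" for \<xi> :: "real ^ 'n"
    using degree_symbol_le [of "m - 1" Pm1 "times_ii \<xi>"] degree_symbol_le [of "m - 2" Pm2 "times_ii \<xi>"] m by linarith+
  then have coeffQ: "coeff (Q \<xi>) m = 1" for \<xi>
    by (simp add: Q_def coeff_symbol_top lead coeff_eq_0)
  have Qnz: "Q \<xi> \<noteq> 0" for \<xi>
    using coeffQ [of \<xi>] by auto
  have degQ: "degree (Q \<xi>) = m" for \<xi>
  proof (rule antisym)
    show "degree (Q \<xi>) \<le> m"
      unfolding Q_def using lowdeg [of \<xi>] by (intro degree_add_le degree_symbol_le) auto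
    show "m \<le> degree (Q \<xi>)"
      using coeffQ [of \<xi>] by (intro le_degree) simp
  qed
  obtain L where L: "\<And>\<xi>. proots (Q \<xi>) = image_mset (\<lambda>j. L j \<xi>) (mset_set {1..m})"
    and limL: "\<And>j. j \<in> {1..m} \<Longrightarrow> (L j \<longlongrightarrow> l j) (nhds 0)"
    using continuous_root_labelling [OF convQ degQ Qnz] by blast
  define p0 where "p0 \<xi>' = symbol m Pm \<xi>'" for \<xi>' :: "real ^ 'n"
  define p1 where "p1 \<xi>' = symbol (m - 1) Pm1 \<xi>'" for \<xi>' :: "real ^ 'n"
  define p2 where "p2 \<xi>' = symbol (m - 2) Pm2 \<xi>'" for \<xi>' :: "real ^ 'n"
  have degp2: "degree (p2 \<xi>') = k" for \<xi>'
  proof (rule antisym)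
    show "degree (p2 \<xi>') \<le> k"
      unfolding p2_def m_eq(3) by (rule degree_symbol_le)
    show "k \<le> degree (p2 \<xi>')"
      using lead(3) coeff_symbol_top [of k Pm2 \<xi>'] by (intro le_degree) (simp add: p2_def m_eq)
  qed
  have inter: "interlace (p2 \<xi>') (p1 \<xi>')" and dist: "distinct (real_roots (p1 \<xi>'))" if "norm \<xi>' = 1" for \<xi>'
    using that inter21 strict by (auto simp: p1_def p2_def strictly_hyperbolic_def)
  have scale: "Q (r *\<^sub>R \<xi>') \<circ>\<^sub>p [:0, \<i> * of_real r:] =
      smult ((\<i> * of_real r) ^ k) (ray_poly (p0 \<xi>') (p1 \<xi>') (p2 \<xi>') r)" for r \<xi>'
    unfolding Q_def ray_poly_def p0_def p1_def p2_def pcompose_add symbol_times_ii_scale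
    by (simp add: m_eq smult_add_right smult_diff_right power2_eq_square mult_ac)
  have "\<exists>\<mu>. ray_expansion (p0 \<xi>') (p1 \<xi>') (p2 \<xi>') \<mu>" if "norm \<xi>' = 1" for \<xi>'
    using ray_labelling [OF inter [OF that] dist [OF that]] .
  then obtain \<mu> where \<mu>: "\<And>\<xi>'. norm \<xi>' = 1 \<Longrightarrow> ray_expansion (p0 \<xi>') (p1 \<xi>') (p2 \<xi>') (\<mu> \<xi>')"
    by metis
  define s where "s \<xi>' j r = \<i> * of_real r * \<mu> \<xi>' j r" for \<xi>' j and r :: real
  \<comment> \<open>The labels are changed only where the roots found on the ray are exactly the small roots, so
    that \<open>lam\<close> labels all roots with multiplicity at every \<open>\<xi>\<close>, even though the
    radius up to which the expansion is available depends on the direction.\<close>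
  define matches where "matches \<xi> \<longleftrightarrow> \<xi> \<noteq> 0 \<and>
    image_mset (\<lambda>j. s (sgn \<xi>) j (norm \<xi>)) (mset_set {1..k}) = image_mset (\<lambda>j. L j \<xi>) (mset_set {1..k})" for \<xi>
  define lam where "lam j \<xi> = (if j \<le> k \<and> matches \<xi> then s (sgn \<xi>) j (norm \<xi>) else L j \<xi>)" for j \<xi>
  note expansion = ray_expansion_def Let_def degp2
  have lam_ray: "\<forall>\<^sub>F r in at_right 0. lam j (r *\<^sub>R \<xi>') = \<i> * of_real r * \<mu> \<xi>' j r"
    if \<xi>': "norm \<xi>' = 1" and j: "j \<in> {1..k}" for \<xi>' j
  proof -
    have ray0: "((\<lambda>r. r *\<^sub>R \<xi>') \<longlongrightarrow> 0) (at_right 0)"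
    proof -
      have "((\<lambda>r. r *\<^sub>R \<xi>') \<longlongrightarrow> 0 *\<^sub>R \<xi>') (at_right 0)"
        by (intro tendsto_intros)
      then show ?thesis by simp
    qed
    have Lray: "((\<lambda>r. L i (r *\<^sub>R \<xi>')) \<longlongrightarrow> l i) (at_right 0)" if "i \<in> {1..m}" for i
      by (rule filterlim_compose [OF limL [OF that] ray0])
    have "\<forall>\<^sub>F r in at_right 0. image_mset (\<lambda>j. \<mu> \<xi>' j r) (mset_set {1..k})
      \<subseteq># proots (ray_poly (p0 \<xi>') (p1 \<xi>') (p2 \<xi>') r)"
      using \<mu> [OF \<xi>'] by (simp add: expansion)
    then have sub: "\<forall>\<^sub>F r in at_right 0. image_mset (\<lambda>j. s \<xi>' j r) (mset_set {1..k}) \<subseteq>#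
      image_mset (\<lambda>j. L j (r *\<^sub>R \<xi>')) (mset_set {1..Suc (Suc k)})"
      using eventually_at_right_less
    proof eventually_elim
      case (elim r)
      let ?c = "\<i> * complex_of_real r"
      have c: "?c \<noteq> 0" using elim by simp
      have "image_mset (\<lambda>j. s \<xi>' j r) (mset_set {1..k}) =
          image_mset ((*) ?c) (image_mset (\<lambda>j. \<mu> \<xi>' j r) (mset_set {1..k}))"
        by (simp add: s_def multiset.map_comp o_def)
      also have "\<dots> \<subseteq># image_mset ((*) ?c) (proots (ray_poly (p0 \<xi>') (p1 \<xi>') (p2 \<xi>') r))"
        using elim(1) by (rule image_mset_subseteq_mono)
      also have "\<dots> = image_mset ((*) ?c) (proots (Q (r *\<^sub>R \<xi>') \<circ>\<^sub>p [:0, ?c:]))"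
        unfolding scale using c by (subst proots_smult) auto
      also have "\<dots> = proots (Q (r *\<^sub>R \<xi>'))"
        by (rule proots_pcompose_scale [OF c])
      finally show ?case
        unfolding L m_eq(1) .
    qed
    have s0: "(s \<xi>' i \<longlongrightarrow> 0) (at_right 0)" if "i \<in> {1..k}" for i
    proof -
      have "(\<mu> \<xi>' i \<longlongrightarrow> of_real (nth_root (p2 \<xi>') i)) (at_right 0)"
        using \<mu> [OF \<xi>'] that by (simp add: expansion)
      from tendsto_mult [OF tendsto_mult [OF tendsto_const [of \<i>] tendsto_of_real_at_right_0] this]
      show ?thesis by (simp add: s_def [abs_def])
    qed
    have "\<forall>\<^sub>F r in at_right 0. image_mset (\<lambda>j. s \<xi>' j r) (mset_set {1..k}) =
      image_mset (\<lambda>j. L j (r *\<^sub>R \<xi>')) (mset_set {1..k})"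
      using small_roots_eq [OF sub s0 Lray Lray] z0 by (simp add: l_def m_eq)
    then show ?thesis
      using eventually_at_right_less
    proof eventually_elim
      case (elim r)
      have "sgn (r *\<^sub>R \<xi>') = \<xi>'" "norm (r *\<^sub>R \<xi>') = r" "r *\<^sub>R \<xi>' \<noteq> 0"
        using elim(2) \<xi>' by (auto simp: sgn_scaleR sgn_div_norm)
      with elim(1) j show ?case
        by (simp add: lam_def matches_def s_def)
    qed
  qed
  have labels: "proots (Q \<xi>) = image_mset (\<lambda>j. lam j \<xi>) (mset_set {1..m})" for \<xi>
  proof -
    have "image_mset (\<lambda>j. lam j \<xi>) (mset_set {1..k}) = image_mset (\<lambda>j. L j \<xi>) (mset_set {1..k})"
    proof (cases "matches \<xi>")
      case True
      then have "image_mset (\<lambda>j. lam j \<xi>) (mset_set {1..k}) = image_mset (\<lambda>j. s (sgn \<xi>) j (norm \<xi>)) (mset_set {1..k})"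
        by (intro image_mset_cong) (auto simp: lam_def)
      with True show ?thesis by (simp add: matches_def)
    qed (simp add: lam_def)
    then show ?thesis
      unfolding L range_m by (simp add: lam_def m_eq)
  qed
  have lam0: "lam j 0 = l j" if "j \<in> {1..m}" for j
    using tendsto_nhds_value [OF limL [OF that]] by (simp add: lam_def matches_def)
  have cont: "isCont (lam j) 0" if j: "j \<in> {1..m}" for j
  proof (cases "j \<le> k")
    case False
    then have "lam j = L j" by (auto simp: lam_def)
    with limL [OF j] lam0 [OF j] show ?thesis
      unfolding isCont_def by (metis filterlim_mono at_within_le_nhds order_refl)
  next
    case True
    \<comment> \<open>Relabelling only permutes the small roots, and these tend to \<open>0\<close> together, uniformly in the direction.\<close>
    have bound: "norm (lam j \<xi>) \<le> (\<Sum>i\<in>{1..k}. norm (L i \<xi>))" for \<xi>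
    proof -
      have "lam j \<xi> \<in> (\<lambda>i. L i \<xi>) ` {1..k}"
      proof (cases "matches \<xi>")
        case True
        then have "(\<lambda>i. s (sgn \<xi>) i (norm \<xi>)) ` {1..k} = (\<lambda>i. L i \<xi>) ` {1..k}"
          unfolding matches_def by (metis finite_atLeastAtMost finite_set_mset_mset_set set_image_mset)
        with True \<open>j \<le> k\<close> j show ?thesis
          by (auto simp: lam_def)
      next
        case False
        with \<open>j \<le> k\<close> j show ?thesis by (auto simp: lam_def)
      qed
      then obtain i where "i \<in> {1..k}" "lam j \<xi> = L i \<xi>" by blast
      then show ?thesis
        using member_le_sum [of i "{1..k}" "\<lambda>i. norm (L i \<xi>)"] by simp
    qed
    have "((\<lambda>\<xi>. \<Sum>i\<in>{1..k}. norm (L i \<xi>)) \<longlongrightarrow> (\<Sum>i\<in>{1..k}. norm (l i))) (nhds 0)"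
      by (intro tendsto_sum tendsto_norm limL) (auto simp: m_eq)
    also have "(\<Sum>i\<in>{1..k}. norm (l i)) = 0"
      by (auto simp: l_def m_eq)
    finally have "(lam j \<longlongrightarrow> 0) (nhds 0)"
      by (rule Lim_null_comparison [rotated]) (intro always_eventually allI bound)
    moreover have "lam j 0 = 0"
      using lam0 [OF j] True by (simp add: l_def m_eq)
    ultimately show ?thesis
      unfolding isCont_def by (metis filterlim_mono at_within_le_nhds order_refl)
  qed
  have at_0: "4 * c2 \<le> c1\<^sup>2 \<Longrightarrow> lam (m - 1) 0 = complex_of_real ((- c1 + sqrt (c1\<^sup>2 - 4 * c2)) / 2)"
    "4 * c2 \<le> c1\<^sup>2 \<Longrightarrow> lam m 0 = complex_of_real ((- c1 - sqrt (c1\<^sup>2 - 4 * c2)) / 2)"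
    "c1\<^sup>2 < 4 * c2 \<Longrightarrow>
      lam (m - 1) 0 = (- complex_of_real c1 + \<i> * complex_of_real (sqrt (4 * c2 - c1\<^sup>2))) / 2"
    "c1\<^sup>2 < 4 * c2 \<Longrightarrow>
      lam m 0 = (- complex_of_real c1 - \<i> * complex_of_real (sqrt (4 * c2 - c1\<^sup>2))) / 2"
    using lam0 [of "m - 1"] lam0 [of m] m by (auto simp: l_def m_eq zp_def zm_def)
  have simple: "(\<lambda>r. lam j (r *\<^sub>R \<xi>') - (\<i> * complex_of_real (r * nth_root (p2 \<xi>') j)
        + complex_of_real (r ^ 2 * (poly (p1 \<xi>') (nth_root (p2 \<xi>') j) / poly (omit_root (p2 \<xi>') j) (nth_root (p2 \<xi>') j)))))
      \<in> o[at_right 0](\<lambda>r. complex_of_real r ^ 2)"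
    if \<xi>': "norm \<xi>' = 1" and j: "j \<in> {1..k}"
      and nz: "poly (omit_root (p2 \<xi>') j) (nth_root (p2 \<xi>') j) \<noteq> 0" for \<xi>' j
  proof -
    have "first_order_expansion (\<mu> \<xi>' j) (nth_root (p2 \<xi>') j)
        (of_real (poly (p1 \<xi>') (nth_root (p2 \<xi>') j) / poly (omit_root (p2 \<xi>') j) (nth_root (p2 \<xi>') j)))"
      using \<mu> [OF \<xi>'] j nz unfolding expansion by blast
    from first_order_smallo [OF this lam_ray [OF \<xi>' j]] show ?thesis
      by (simp only: of_real_mult)
  qed
  have common: "(\<lambda>r. lam j (r *\<^sub>R \<xi>') - (\<i> * complex_of_real (r * nth_root (p2 \<xi>') j)
        + \<i> * complex_of_real (r ^ 3 * (poly (p0 \<xi>') (nth_root (p2 \<xi>') j) / poly (omit_root (p2 \<xi>') j) (nth_root (p2 \<xi>') j)))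
        + complex_of_real (r ^ 4 * (poly (p0 \<xi>') (nth_root (p2 \<xi>') j) *
            poly (if nth_root (p2 \<xi>') j = nth_root (p1 \<xi>') j then omit_root (p1 \<xi>') j else omit_root (p1 \<xi>') (j + 1))
              (nth_root (p2 \<xi>') j) / (poly (omit_root (p2 \<xi>') j) (nth_root (p2 \<xi>') j))\<^sup>2))))
      \<in> o[at_right 0](\<lambda>r. complex_of_real r ^ 4)"
    if \<xi>': "norm \<xi>' = 1" and j: "j \<in> {1..k}" and root: "poly (p1 \<xi>') (nth_root (p2 \<xi>') j) = 0"
      and nz: "poly (omit_root (p2 \<xi>') j) (nth_root (p2 \<xi>') j) \<noteq> 0" for \<xi>' j
    using \<mu> [OF \<xi>'] j root nz unfolding expansion
    by (intro third_order_smallo [OF _ lam_ray [OF \<xi>' j]]) blast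
  have double: "\<exists>\<kappa>p \<kappa>m :: complex.
      proots [:complex_of_real (poly (p0 \<xi>') (nth_root (p2 \<xi>') j)),
        - complex_of_real (poly (omit_root (p1 \<xi>') (j + 1)) (nth_root (p2 \<xi>') j)),
        complex_of_real (poly (omit_root2 (p2 \<xi>') j) (nth_root (p2 \<xi>') j)):] = {#\<kappa>p, \<kappa>m#} \<and>
      (\<lambda>r. lam j (r *\<^sub>R \<xi>') -
        (\<i> * complex_of_real (r * nth_root (p2 \<xi>') j) + complex_of_real (r ^ 2) * \<kappa>p))
        \<in> o[at_right 0](\<lambda>r. complex_of_real r ^ 2) \<and>
      (\<lambda>r. lam (j + 1) (r *\<^sub>R \<xi>') -
        (\<i> * complex_of_real (r * nth_root (p2 \<xi>') j) + complex_of_real (r ^ 2) * \<kappa>m))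
        \<in> o[at_right 0](\<lambda>r. complex_of_real r ^ 2)"
    if \<xi>': "norm \<xi>' = 1" and j: "j \<in> {1..<k}"
      and eq: "nth_root (p2 \<xi>') j = nth_root (p2 \<xi>') (j + 1)" for \<xi>' j
  proof -
    from \<mu> [OF \<xi>'] j eq obtain \<kappa>p \<kappa>m where
      \<kappa>: "proots [:complex_of_real (poly (p0 \<xi>') (nth_root (p2 \<xi>') j)),
        - of_real (poly (omit_root (p1 \<xi>') (j + 1)) (nth_root (p2 \<xi>') j)),
        of_real (poly (omit_root2 (p2 \<xi>') j) (nth_root (p2 \<xi>') j)):] = {#\<kappa>p, \<kappa>m#}"
      and exp: "first_order_expansion (\<mu> \<xi>' j) (nth_root (p2 \<xi>') j) \<kappa>p"
        "first_order_expansion (\<mu> \<xi>' (j + 1)) (nth_root (p2 \<xi>') j) \<kappa>m"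
      unfolding expansion by blast
    have "j \<in> {1..k}" "j + 1 \<in> {1..k}"
      using j by auto
    with \<kappa> first_order_smallo [OF exp(1) lam_ray [OF \<xi>']] first_order_smallo [OF exp(2) lam_ray [OF \<xi>']]
    show ?thesis by blast
  qed
  note results = labels cont at_0 simple common double
  note results' = results [unfolded Q_def c1_def c2_def p0_def p1_def p2_def m_eq(3) [symmetric]]
  show ?thesis
    unfolding Let_def
    by (intro exI [of _ lam] conjI allI impI ballI; (elim conjE)?; rule results'; (assumption | simp only:))
qed

end
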